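(* Let $(R,\mathfrak{m})$ be a Noetherian local ring, $J$ an arbitrary ideal of $R$, and let $f_1,\ldots,f_r$ be a $J$-filter regular sequence in $R$. Put $I=(f_1,\ldots,f_r)$. For $i=1,\ldots,r$, let $$a_i=a_J\left(\frac{(f_1,\ldots,f_{i-1}):f_i}{(f_1,\ldots,f_{i-1})}\right).$$ Set $b:=\max_{1\le i\le r} a_i$ and $$N=\max\left\{a_1+\cdots+a_r+b,\ \mathrm{ar}_J(f_1),\ \ldots,\ \mathrm{ar}_J(f_1,\ldots,f_r)\right\}+1.$$ For all $\varepsilon_1,\ldots,\varepsilon_r\in J^N$, put $f_i'=f_i+\varepsilon_i$ for $i=1,\ldots,r$ and $I'=(f_1',\ldots,f_r')$. Then: (i) $f_1',\ldots,f_r'$ is a $J$-filter regular sequence with $$a_J\left(\frac{(f_1',\ldots,f_{i-1}'):f_i'}{(f_1',\ldots,f_{i-1}')}\right)=a_i\qquad\text{for } i=1,\ldots,r.$$ (ii) $\mathrm{in}(f_1',\ldots,f_i')=\mathrm{in}(f_1,\ldots,f_i)$ for $i=1,\ldots,r$. (iii) In particular, $\mathrm{gr}_J(R/I')\cong\mathrm{gr}_J(R/I)$ and $\mathrm{ar}_J(I')=\mathrm{ar}_J(I)$.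
   Context: Let $(R,\mathfrak m)$ be a Noetherian local ring and $J$ an ideal of $R$. - For a finitely generated $R$-module $M$, the $J$-Loewy length is $a_J(M)=\inf\{n\ge 0\mid J^nM=0\}$, with $a_J(M)=\infty$ if no such $n$ exists. - A sequence $f_1,\ldots,f_r$ in $R$ is $J$-filter regular if $a_J\big(((f_1,\ldots,f_{i-1}):f_i)/(f_1,\ldots,f_{i-1})\big)<\infty$ for every $i=1,\ldots,r$ (for $i=1$ the ideal $(f_1,\ldots,f_{i-1})$ is $0$). - For an ideal $I$ of $R$, $\mathrm{gr}_J(R/I)=\bigoplus_{n\ge 0}(J^n+I)/(J^{n+1}+I)$ is the associated graded ring, and $\mathrm{in}(I)$ is the initial ideal of $I$ in $\mathrm{gr}_J(R)=\bigoplus_{n\ge0}J^n/J^{n+1}$, i.e. the homogeneous ideal $\bigoplus_{n\ge 0}\big((I\cap J^n)+J^{n+1}\big)/J^{n+1}$, so that $\mathrm{gr}_J(R/I)\cong \mathrm{gr}_J(R)/\mathrm{in}(I)$. One writes $\mathrm{in}(g_1,\ldots,g_s)$ for the initial ideal of the ideal $(g_1,\ldots,g_s)$. - The Artin–Rees number $\mathrm{ar}_J(I)$ is the least integer $c\ge 0$ such that $J^{n+1}\cap I=J(J^n\cap I)$ for all $n\ge c$; $\mathrm{ar}_J(g_1,\ldots,g_s)$ means $\mathrm{ar}_J((g_1,\ldots,g_s))$.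
   Formalization: The ideal J is assumed proper rather than arbitrary; for J = R the claim fails, e.g. R a field, f_1 = 1, ε_1 = −1 gives f_1' = 0, which is not J-filter regular. *)

theory Defs
  imports "HOL-Library.Extended_Nat" "HOL-Algebra.Algebra"
begin

definition local_ring :: "('a, 'b) ring_scheme \<Rightarrow> 'a set \<Rightarrow> bool" where
  "local_ring R \<mm> \<longleftrightarrow> cring R \<and> (\<forall>M. maximalideal M R \<longleftrightarrow> M = \<mm>)"

text \<open>Powers of an ideal are taken in the library's semiring of ideals, so \<open>J\<close> to the power
  \<open>0\<close> is the whole ring.\<close>

abbreviation ideal_pow :: "('a, 'b) ring_scheme \<Rightarrow> 'a set \<Rightarrow> nat \<Rightarrow> 'a set" where
  "ideal_pow R J n \<equiv> J [^]\<^bsub>ideals_set R\<^esub> n"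

definition colon_ideal :: "('a, 'b) ring_scheme \<Rightarrow> 'a set \<Rightarrow> 'a \<Rightarrow> 'a set" where
  "colon_ideal R I f = {a \<in> carrier R. a \<otimes>\<^bsub>R\<^esub> f \<in> I}"

text \<open>The \<open>R\<close>-module \<open>A/B\<close> for ideals \<open>B \<subseteq> A\<close>; the fields \<open>mult\<close> and \<open>one\<close> of the
  module record carry no meaning for a module.\<close>

definition quot_module ::
  "('a, 'b) ring_scheme \<Rightarrow> 'a set \<Rightarrow> 'a set \<Rightarrow> ('a, 'a set) module" where
  "quot_module R A B =
    \<lparr>carrier = (\<lambda>a. B +>\<^bsub>R\<^esub> a) ` A, monoid.mult = undefined, one = undefined,
     ring.zero = B, ring.add = set_add R,
     smult = (\<lambda>r C. \<Union>x\<in>C. B +>\<^bsub>R\<^esub> (r \<otimes>\<^bsub>R\<^esub> x))\<rparr>"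

text \<open>The submodule \<open>J M\<close> of \<open>M\<close>, generated by all products.\<close>

definition ideal_smult ::
  "('a, 'b) ring_scheme \<Rightarrow> 'a set \<Rightarrow> ('a, 'c, 'd) module_scheme \<Rightarrow> 'c set" where
  "ideal_smult R J M =
    \<Inter>{N. submodule N R M \<and> (\<forall>r\<in>J. \<forall>x\<in>carrier M. r \<odot>\<^bsub>M\<^esub> x \<in> N)}"

text \<open>The \<open>J\<close>-Loewy length; the infimum of the empty set in \<^typ>\<open>enat\<close> is \<open>\<infinity>\<close>.\<close>

definition loewy_length ::
  "('a, 'b) ring_scheme \<Rightarrow> 'a set \<Rightarrow> ('a, 'c, 'd) module_scheme \<Rightarrow> enat" where
  "loewy_length R J M =
    Inf {enat n |n. ideal_smult R (ideal_pow R J n) M = {\<zero>\<^bsub>M\<^esub>}}"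

text \<open>Sequences \<open>f\<^sub>1, \<dots>, f\<^sub>r\<close> are functions on \<^typ>\<open>nat\<close> of which only the values
  at \<open>1, \<dots>, r\<close> matter.\<close>

abbreviation seq_ideal :: "('a, 'b) ring_scheme \<Rightarrow> (nat \<Rightarrow> 'a) \<Rightarrow> nat \<Rightarrow> 'a set" where
  "seq_ideal R f i \<equiv> genideal R (f ` {1..i})"

text \<open>The module \<open>((f\<^sub>1, \<dots>, f\<^sub>i\<^sub>-\<^sub>1) : f\<^sub>i) / (f\<^sub>1, \<dots>, f\<^sub>i\<^sub>-\<^sub>1)\<close>, for \<open>i \<ge> 1\<close>.\<close>

definition colon_quot ::
  "('a, 'b) ring_scheme \<Rightarrow> (nat \<Rightarrow> 'a) \<Rightarrow> nat \<Rightarrow> ('a, 'a set) module" where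
  "colon_quot R f i =
    quot_module R (colon_ideal R (seq_ideal R f (i - 1)) (f i)) (seq_ideal R f (i - 1))"

definition filter_regular ::
  "('a, 'b) ring_scheme \<Rightarrow> 'a set \<Rightarrow> nat \<Rightarrow> (nat \<Rightarrow> 'a) \<Rightarrow> bool" where
  "filter_regular R J r f \<longleftrightarrow>
    (\<forall>i\<in>{1..r}. f i \<in> carrier R) \<and>
    (\<forall>i\<in>{1..r}. loewy_length R J (colon_quot R f i) < \<infinity>)"

text \<open>The graded ring \<open>F\<^sub>0/F\<^sub>1 \<oplus> F\<^sub>1/F\<^sub>2 \<oplus> \<dots>\<close> of a descending multiplicative
  filtration \<open>F\<close> of \<open>R\<close> by ideals with \<open>F\<^sub>0 = R\<close>.  An element is the family of its
  homogeneous components; the component of degree \<open>n\<close> is a coset of \<open>F\<^sub>n\<^sub>+\<^sub>1\<close> with a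
  representative in \<open>F\<^sub>n\<close>, and the coset \<open>F\<^sub>n\<^sub>+\<^sub>1\<close> itself is zero in degree \<open>n\<close>.
  A product of a coset of \<open>F\<^sub>i\<^sub>+\<^sub>1\<close> in \<open>F\<^sub>i\<close> and a coset of \<open>F\<^sub>j\<^sub>+\<^sub>1\<close> in \<open>F\<^sub>j\<close>
  is formed modulo \<open>F\<^sub>i\<^sub>+\<^sub>j\<^sub>+\<^sub>1\<close>.\<close>

definition graded_ring :: "('a, 'b) ring_scheme \<Rightarrow> (nat \<Rightarrow> 'a set) \<Rightarrow> (nat \<Rightarrow> 'a set) ring" where
  "graded_ring R F =
    \<lparr>carrier = {x. (\<forall>n. x n \<in> (\<lambda>a. F (Suc n) +>\<^bsub>R\<^esub> a) ` F n) \<and>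
                    finite {n. x n \<noteq> F (Suc n)}},
     monoid.mult = (\<lambda>x y n. finsum (R Quot F (Suc n))
                       (\<lambda>i. rcoset_mult R (F (Suc n)) (x i) (y (n - i))) {..n}),
     one = (\<lambda>n. if n = 0 then F (Suc 0) +>\<^bsub>R\<^esub> \<one>\<^bsub>R\<^esub> else F (Suc n)),
     ring.zero = (\<lambda>n. F (Suc n)),
     ring.add = (\<lambda>x y n. x n <+>\<^bsub>R\<^esub> y n)\<rparr>"

definition homogeneous_part ::
  "('a, 'b) ring_scheme \<Rightarrow> (nat \<Rightarrow> 'a set) \<Rightarrow> nat \<Rightarrow> (nat \<Rightarrow> 'a set) set" where
  "homogeneous_part R F n =
    {x \<in> carrier (graded_ring R F). \<forall>k. k \<noteq> n \<longrightarrow> x k = F (Suc k)}"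

definition graded_iso ::
  "('a, 'b) ring_scheme \<Rightarrow> (nat \<Rightarrow> 'a set) \<Rightarrow> (nat \<Rightarrow> 'a set) \<Rightarrow> bool" where
  "graded_iso R F G \<longleftrightarrow>
    (\<exists>h \<in> ring_iso (graded_ring R F) (graded_ring R G).
       \<forall>n. h ` homogeneous_part R F n = homogeneous_part R G n)"

text \<open>The filtration of \<open>R\<close> whose graded ring is that of \<open>R/I\<close> with respect to \<open>J\<close>.\<close>

definition adic_filtration ::
  "('a, 'b) ring_scheme \<Rightarrow> 'a set \<Rightarrow> 'a set \<Rightarrow> nat \<Rightarrow> 'a set" where
  "adic_filtration R J I n = ideal_pow R J n <+>\<^bsub>R\<^esub> I"

text \<open>The initial ideal of \<open>I\<close>, as a set of elements of the graded ring of \<open>R\<close> with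
  respect to \<open>J\<close>.\<close>

definition initial_ideal ::
  "('a, 'b) ring_scheme \<Rightarrow> 'a set \<Rightarrow> 'a set \<Rightarrow> (nat \<Rightarrow> 'a set) set" where
  "initial_ideal R J I =
    {x \<in> carrier (graded_ring R (ideal_pow R J)).
       \<forall>n. x n \<in> (\<lambda>a. ideal_pow R J (Suc n) +>\<^bsub>R\<^esub> a) ` (I \<inter> ideal_pow R J n)}"

text \<open>In a Noetherian ring such a \<open>c\<close> exists by the Artin--Rees lemma.\<close>

definition artin_rees :: "('a, 'b) ring_scheme \<Rightarrow> 'a set \<Rightarrow> 'a set \<Rightarrow> nat" where
  "artin_rees R J I =
    (LEAST c. \<forall>n\<ge>c. ideal_pow R J (Suc n) \<inter> I = ideal_prod R J (ideal_pow R J n \<inter> I))"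

end

theory Submission
  imports Defs "HOL-Library.Multiset_Order"
begin

text \<open>The elements are perturbed one at a time. Each step preserves the \<open>a\<^sub>i\<close>, the initial ideals
  and the Artin--Rees numbers, so the bound on \<open>N\<close> survives. Let \<open>g = f\<^sub>j\<close> be replaced by
  \<open>g + \<epsilon>\<close>, and write \<open>(f\<^sub>1, \<dots>, f\<^sub>i) = K + (g)\<close> with \<open>K\<close> generated by the other elements.
  Eliminating the later elements one after the other shows that \<open>J\<close> to the power
  \<open>a\<^sub>j + \<dots> + a\<^sub>i\<close> multiplies \<open>K : g\<close> into \<open>K\<close>; hence so does \<open>\<epsilon>\<close>. By Artin--Rees, the
  coefficient of \<open>g\<close> in an element of \<open>K + (g)\<close> of order \<open>N + k\<close> can be chosen of order \<open>k + 1\<close>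
  up to \<open>K : g\<close>, so passing from \<open>g\<close> to \<open>g + \<epsilon>\<close> changes the element in higher order only. This
  gives the equality of initial ideals and, by Krull's intersection theorem,
  \<open>K : (g + \<epsilon>) = K : g\<close>. The Artin--Rees number is determined by the initial ideal. For \<open>i > j\<close>
  the bound on the Loewy length is obtained by lifting relations of \<open>f\<close> to relations of \<open>f'\<close>,
  the error being absorbed by Nakayama's lemma; the reverse bound follows by perturbing \<open>f'\<close>
  back to \<open>f\<close>.\<close>

section \<open>Ideals and their powers\<close>

text \<open>With a single moving generator \<open>g\<close>, the coefficient of \<open>g\<close> in
  an element of \<open>K + (g)\<close> is unique up to the ideal \<open>K : g\<close>; with several
  moving generators the ambiguity would be a module of syzygies.

  The summand 1 in \<open>N\<close> buys a factor of \<open>J\<close> twice. In Artin--Rees the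
  coefficient of \<open>g\<close> gets order k + 1 instead of k, so that its product with \<epsilon>
  has larger order than the element itself. In the Nakayama step \<epsilon> still has a factor in
  \<open>J\<close> after the powers needed to kill the colon ideals have been spent.

  Equal initial ideals do not by themselves control the Loewy lengths for i > j, hence the separate
  lifting of relations. It yields upper bounds only, so everything is phrased by inclusions
  (\<open>kills\<close>) instead of exact lengths; this is also what permits perturbing back with a
  smaller exponent.

  Since \<open>artin_rees\<close> is a \<open>LEAST\<close>, a bound on it says something only once
  the Artin--Rees lemma is known, and Krull's theorem rests on that lemma too. It is proved with
  ideals of leading coefficients inside \<open>R\<close>, without passing to the Rees
  algebra.\<close>

context cring
begin

lemma ideal_a_closed: "ideal I R \<Longrightarrow> x \<in> I \<Longrightarrow> y \<in> I \<Longrightarrow> x \<oplus> y \<in> I"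
  by (rule additive_subgroup.a_closed[OF ideal.axioms(1)])

lemma ideal_a_inv_closed: "ideal I R \<Longrightarrow> x \<in> I \<Longrightarrow> \<ominus> x \<in> I"
  by (simp add: additive_subgroup.a_inv_closed ideal.axioms(1))

lemma ideal_a_minus_closed: "ideal I R \<Longrightarrow> x \<in> I \<Longrightarrow> y \<in> I \<Longrightarrow> x \<ominus> y \<in> I"
  by (simp add: a_minus_def ideal_a_closed ideal_a_inv_closed)

lemma ideal_zero_closed: "ideal I R \<Longrightarrow> \<zero> \<in> I"
  by (simp add: additive_subgroup.zero_closed ideal.axioms(1))

lemma a_minus_eqI: "x = p \<oplus> w \<Longrightarrow> p \<in> carrier R \<Longrightarrow> w \<in> carrier R \<Longrightarrow> x \<ominus> w = p"
  by (simp add: a_minus_def a_assoc r_neg)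

lemmas ideal_closed = ideal_a_closed ideal_a_minus_closed ideal_a_inv_closed ideal_zero_closed
  ideal.I_l_closed ideal.I_r_closed

lemma ideal_carr: "ideal I R \<Longrightarrow> x \<in> I \<Longrightarrow> x \<in> carrier R"
  by (rule ideal.Icarr)

lemma ideal_memI:
  assumes "I \<subseteq> carrier R" "\<zero> \<in> I" "\<And>x y. x \<in> I \<Longrightarrow> y \<in> I \<Longrightarrow> x \<oplus> y \<in> I"
    "\<And>x y. x \<in> I \<Longrightarrow> y \<in> carrier R \<Longrightarrow> y \<otimes> x \<in> I"
  shows "ideal I R"
proof (rule idealI)
  have inv: "\<ominus> x \<in> I" if "x \<in> I" for x
    using assms(4)[OF that, of "\<ominus> \<one>"] that assms(1) by (auto simp: l_minus)
  show "subgroup I (add_monoid R)"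
    using assms inv by (intro add.subgroupI) (auto simp: a_inv_def)
  show "y \<otimes> x \<in> I" "x \<otimes> y \<in> I" if "x \<in> I" "y \<in> carrier R" for x y
    using assms(4)[OF that] m_comm[of x y] that assms(1) by auto
qed (rule ring_axioms)

lemma set_add_iff: "x \<in> I <+>\<^bsub>R\<^esub> K \<longleftrightarrow> (\<exists>a\<in>I. \<exists>b\<in>K. x = a \<oplus> b)"
  by (auto simp: set_add_def')

lemma subset_set_add:
  assumes "ideal I R" "ideal K R"
  shows "I \<subseteq> I <+>\<^bsub>R\<^esub> K" "K \<subseteq> I <+>\<^bsub>R\<^esub> K"
proof -
  have "\<zero> \<in> I" "\<zero> \<in> K" using assms by (auto intro: ideal_zero_closed)
  thus "I \<subseteq> I <+>\<^bsub>R\<^esub> K" "K \<subseteq> I <+>\<^bsub>R\<^esub> K"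
    using ideal_carr[OF assms(1)] ideal_carr[OF assms(2)] unfolding set_add_def'
    by (force intro: l_zero[symmetric] r_zero[symmetric])+
qed

lemma genideal_insert_iff:
  assumes "S \<subseteq> carrier R" "g \<in> carrier R"
  shows "x \<in> Idl (insert g S) \<longleftrightarrow> (\<exists>p\<in>Idl S. \<exists>y\<in>carrier R. x = p \<oplus> y \<otimes> g)"
proof
  have S: "ideal (Idl S) R" by (rule genideal_ideal[OF assms(1)])
  let ?T = "Idl S <+>\<^bsub>R\<^esub> PIdl g"
  have T: "ideal ?T R" using S assms by (intro add_ideals cgenideal_ideal)
  have "insert g S \<subseteq> ?T"
    using subset_set_add[OF S cgenideal_ideal[OF assms(2)]] cgenideal_self[OF assms(2)]
      genideal_self[OF assms(1)] by blast
  hence "Idl (insert g S) \<subseteq> ?T" by (rule genideal_minimal[OF T])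
  thus "x \<in> Idl (insert g S) \<Longrightarrow> \<exists>p\<in>Idl S. \<exists>y\<in>carrier R. x = p \<oplus> y \<otimes> g"
    by (fastforce simp: set_add_iff cgenideal_def)
next
  have I: "ideal (Idl (insert g S)) R" using assms by (intro genideal_ideal) auto
  have "Idl S \<subseteq> Idl (insert g S)" using assms by (intro subset_Idl_subset) auto
  moreover have "g \<in> Idl (insert g S)" using assms genideal_self[of "insert g S"] by auto
  ultimately show "\<exists>p\<in>Idl S. \<exists>y\<in>carrier R. x = p \<oplus> y \<otimes> g \<Longrightarrow> x \<in> Idl (insert g S)"
    using I by (auto intro!: ideal_a_closed ideal.I_l_closed)
qed

lemma ideal_colon_ideal:
  assumes "ideal K R" "g \<in> carrier R"
  shows "ideal (colon_ideal R K g) R"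
  using assms unfolding colon_ideal_def
  by (intro ideal_memI) (auto simp: l_distr m_assoc ideal_closed)

text \<open>Bilinear extension from generators: the elements multiplying a fixed element into
  \<open>T\<close> form a colon ideal, which contains the generated ideal once it contains the
  generators. This is applied to the second factor, then to the first.\<close>

lemma genideal_mult_subset:
  assumes "A \<subseteq> carrier R" "B \<subseteq> carrier R" "ideal T R"
    and "\<And>a b. a \<in> A \<Longrightarrow> b \<in> B \<Longrightarrow> a \<otimes> b \<in> T" and x: "x \<in> Idl A" and y: "y \<in> Idl B"
  shows "x \<otimes> y \<in> T"
proof -
  have 1: "a \<otimes> y' \<in> T" if "a \<in> A" "y' \<in> Idl B" for a y'
  proof -
    have "B \<subseteq> colon_ideal R T a"
    proof
      fix b assume b: "b \<in> B"
      hence "a \<otimes> b = b \<otimes> a" using that assms by (intro m_comm) auto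
      thus "b \<in> colon_ideal R T a" using assms(2) assms(4)[OF that(1) b] b
        by (auto simp: colon_ideal_def)
    qed
    hence "Idl B \<subseteq> colon_ideal R T a"
      using assms that by (intro genideal_minimal ideal_colon_ideal) auto
    hence "y' \<in> carrier R" "y' \<otimes> a \<in> T" using that by (auto simp: colon_ideal_def)
    thus ?thesis using m_comm[of a y'] that assms by auto
  qed
  have yc: "y \<in> carrier R" using y ideal_carr[OF genideal_ideal[OF assms(2)]] by blast
  have "A \<subseteq> colon_ideal R T y" using 1 y assms by (auto simp: colon_ideal_def)
  hence "Idl A \<subseteq> colon_ideal R T y" using assms yc by (intro genideal_minimal ideal_colon_ideal)
  thus ?thesis using x by (auto simp: colon_ideal_def)
qed

lemma ideal_prod_subsetI:
  assumes "ideal T R" "\<And>a b. a \<in> A \<Longrightarrow> b \<in> B \<Longrightarrow> a \<otimes> b \<in> T"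
  shows "ideal_prod R A B \<subseteq> T"
proof
  fix x assume "x \<in> ideal_prod R A B"
  thus "x \<in> T"
  proof induct
    case (prod i j)
    thus ?case by (rule assms(2))
  next
    case (sum s1 s2)
    thus ?case using assms(1) by (intro ideal_a_closed)
  qed
qed

lemma ideal_prod_mono:
  assumes "A \<subseteq> A'" "B \<subseteq> B'"
  shows "ideal_prod R A B \<subseteq> ideal_prod R A' B'"
proof
  fix x assume "x \<in> ideal_prod R A B"
  thus "x \<in> ideal_prod R A' B'"
  proof induct
    case (prod i j)
    thus ?case using assms by (intro ideal_prod.prod) auto
  qed (rule ideal_prod.sum)
qed

end

locale adic_ring = cring R for R (structure) +
  fixes J assumes ideal_J: "ideal J R"
begin

abbreviation P :: "nat \<Rightarrow> 'a set" where "P n \<equiv> ideal_pow R J n"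

lemma P_0: "P 0 = carrier R"
  by (simp add: ideals_set_def)

lemma P_Suc: "P (Suc n) = ideal_prod R (P n) J"
  by (simp add: ideals_set_def)

lemma ideal_P: "ideal (P n) R"
proof (induct n)
  case 0
  show ?case unfolding P_0 by (rule oneideal)
next
  case (Suc n)
  thus ?case unfolding P_Suc by (intro ideal_prod_is_ideal ideal_J)
qed

lemma P_add: "P (m + n) = ideal_prod R (P m) (P n)"
proof -
  interpret I: comm_monoid "ideals_set R" by (rule ideals_set_is_comm_monoid)
  have "J \<in> carrier (ideals_set R)" using ideal_J by (simp add: ideals_set_def)
  from I.nat_pow_mult[OF this, of m n] show ?thesis by (simp add: ideals_set_def)
qed

lemma P_1: "P (Suc 0) = J"
  by (metis P_0 P_Suc ideal_J ideal_prod_commute ideal_prod_one oneideal)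

lemma P_mult: "x \<in> P m \<Longrightarrow> y \<in> P n \<Longrightarrow> x \<otimes> y \<in> P (m + n)"
  unfolding P_add by (rule ideal_prod.prod)

lemma P_antimono: "m \<le> n \<Longrightarrow> P n \<subseteq> P m"
  using ideal_prod_inter[OF ideal_P ideal_P, of m "n - m"] P_add[of m "n - m"] by auto

lemma P_carr: "x \<in> P n \<Longrightarrow> x \<in> carrier R"
  by (rule ideal_carr[OF ideal_P])

lemma ideal_prod_P_inter:
  assumes "ideal I R"
  shows "ideal (ideal_prod R J (P n \<inter> I)) R" "ideal_prod R J (P n \<inter> I) \<subseteq> P (Suc n) \<inter> I"
proof -
  show "ideal (ideal_prod R J (P n \<inter> I)) R" by (intro ideal_prod_is_ideal ideal_J i_intersect ideal_P assms)
  show "ideal_prod R J (P n \<inter> I) \<subseteq> P (Suc n) \<inter> I"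
  proof (rule ideal_prod_subsetI)
    show "ideal (P (Suc n) \<inter> I) R" by (intro i_intersect ideal_P assms)
    fix a b assume ab: "a \<in> J" "b \<in> P n \<inter> I"
    hence "a \<in> P (Suc 0)" "b \<in> P n" unfolding P_1 by simp_all
    hence "a \<otimes> b \<in> P (Suc 0 + n)" by (rule P_mult)
    moreover have "a \<otimes> b \<in> I" using ab ideal_carr[OF ideal_J] by (intro ideal.I_l_closed[OF assms]) auto
    ultimately show "a \<otimes> b \<in> P (Suc n) \<inter> I" by simp
  qed
qed

end

section \<open>The Artin--Rees lemma\<close>

text \<open>Some subsequence is monotone. If it decreases, it is constant from the place where it
  attains its minimum, and that tail is taken.\<close>

lemma nat_seq_incseq_subseq:
  fixes s :: "nat \<Rightarrow> nat"
  shows "\<exists>\<phi> :: nat \<Rightarrow> nat. strict_mono \<phi> \<and> mono (\<lambda>n. s (\<phi> n))"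
proof -
  obtain \<phi> :: "nat \<Rightarrow> nat" where \<phi>: "strict_mono \<phi>" "monoseq (\<lambda>n. s (\<phi> n))"
    using seq_monosub by blast
  show ?thesis
  proof (cases "mono (\<lambda>n. s (\<phi> n))")
    case False
    then have dec: "decseq (\<lambda>n. s (\<phi> n))" using \<phi>(2) monoseq_iff by blast
    define m where "m = (LEAST v. \<exists>n. v = s (\<phi> n))"
    have "\<exists>n. m = s (\<phi> n)" unfolding m_def by (rule LeastI[of _ "s (\<phi> 0)"]) blast
    then obtain n0 where n0: "m = s (\<phi> n0)" by blast
    have "s (\<phi> (n0 + n)) = m" for n
      using decseqD[OF dec, of n0 "n0 + n"] n0 Least_le[of "\<lambda>v. \<exists>n. v = s (\<phi> n)" "s (\<phi> (n0 + n))"]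
      unfolding m_def[symmetric] by (metis le_add1 le_antisym)
    moreover have "strict_mono (\<lambda>n. \<phi> (n0 + n))" using \<phi>(1) by (simp add: strict_mono_def)
    ultimately show ?thesis by (intro exI[of _ "\<lambda>n. \<phi> (n0 + n)"]) (simp add: mono_def)
  qed (use \<phi> in blast)
qed

text \<open>Dickson's lemma in the form of a divisibility chain. The sequence is thinned out once
  for each index in \<open>D\<close>; multiplicities outside \<open>D\<close> are zero.\<close>

lemma multiset_seq_incseq_subseq:
  fixes s :: "nat \<Rightarrow> 'c multiset"
  assumes "finite D" "\<And>n. set_mset (s n) \<subseteq> D"
  shows "\<exists>\<phi> :: nat \<Rightarrow> nat. strict_mono \<phi> \<and> (\<forall>m n. m \<le> n \<longrightarrow> s (\<phi> m) \<subseteq># s (\<phi> n))"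
proof -
  have "\<exists>\<phi> :: nat \<Rightarrow> nat. strict_mono \<phi> \<and> (\<forall>k\<in>D. mono (\<lambda>n. count (s (\<phi> n)) k))"
    using assms(1)
  proof (induct D)
    case empty
    show ?case by (intro exI[of _ id]) (auto simp: strict_mono_def)
  next
    case (insert k D)
    then obtain \<phi> :: "nat \<Rightarrow> nat" where \<phi>: "strict_mono \<phi>" "\<forall>k\<in>D. mono (\<lambda>n. count (s (\<phi> n)) k)" by blast
    obtain \<psi> :: "nat \<Rightarrow> nat" where \<psi>: "strict_mono \<psi>" "mono (\<lambda>n. count (s (\<phi> (\<psi> n))) k)"
      using nat_seq_incseq_subseq[of "\<lambda>n. count (s (\<phi> n)) k"] by blast
    have "mono (\<lambda>n. count (s (\<phi> (\<psi> n))) k')" if "k' \<in> D" for k'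
    proof (rule monoI)
      fix m n :: nat assume "m \<le> n"
      hence "\<psi> m \<le> \<psi> n" using \<psi>(1) by (simp add: strict_mono_less_eq)
      thus "count (s (\<phi> (\<psi> m))) k' \<le> count (s (\<phi> (\<psi> n))) k'"
        using \<phi>(2) that monoD by blast
    qed
    hence "\<forall>k'\<in>insert k D. mono (\<lambda>n. count (s ((\<phi> \<circ> \<psi>) n)) k')" using \<psi>(2) by simp
    thus ?case using strict_mono_o[OF \<phi>(1) \<psi>(1)] by blast
  qed
  then obtain \<phi> :: "nat \<Rightarrow> nat" where \<phi>: "strict_mono \<phi>" "\<forall>k\<in>D. mono (\<lambda>n. count (s (\<phi> n)) k)" by blast
  have "s (\<phi> m) \<subseteq># s (\<phi> n)" if "m \<le> n" for m n
  proof (rule mset_subset_eqI)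
    fix k show "count (s (\<phi> m)) k \<le> count (s (\<phi> n)) k"
    proof (cases "k \<in> D")
      case True
      thus ?thesis using \<phi>(2) that monoD by blast
    next
      case False
      hence "k \<notin># s (\<phi> m)" using assms(2) by blast
      thus ?thesis by (simp add: not_in_iff)
    qed
  qed
  thus ?thesis using \<phi>(1) by blast
qed

lemma finite_msets_size: "finite D \<Longrightarrow> finite {M. size M = n \<and> set_mset M \<subseteq> D}"
proof (rule finite_subset)
  assume "finite D"
  thus "finite (mset ` {xs. set xs \<subseteq> D \<and> length xs = n})" using finite_lists_length_eq by blast
  show "{M. size M = n \<and> set_mset M \<subseteq> D} \<subseteq> mset ` {xs. set xs \<subseteq> D \<and> length xs = n}"
  proof
    fix M assume M: "M \<in> {M. size M = n \<and> set_mset M \<subseteq> D}"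
    obtain xs where "M = mset xs" by (metis ex_mset)
    thus "M \<in> mset ` {xs. set xs \<subseteq> D \<and> length xs = n}" using M by auto
  qed
qed

text \<open>The union of a chain of ideals is a member of the chain, so Zorn's lemma applies to any
  family of ideals. This form serves ascending sequences, the maximal ideal above a proper ideal,
  and Nakayama's lemma.\<close>

lemma (in noetherian_ring) ideal_family_maximal:
  assumes "\<F> \<noteq> {}" "\<And>I. I \<in> \<F> \<Longrightarrow> ideal I R"
  shows "\<exists>M \<in> \<F>. \<forall>Y \<in> \<F>. M \<subseteq> Y \<longrightarrow> Y = M"
proof (rule subset_Zorn_nonempty[OF assms(1)])
  fix C assume C: "C \<noteq> {}" "subset.chain \<F> C"
  have "subset.chain {I. ideal I R} C" using C(2) assms(2) by (auto simp: pred_on.chain_def)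
  hence "\<Union>C \<in> C" by (rule ideal_chain_is_trivial[OF C(1)])
  thus "\<Union>C \<in> \<F>" using C(2) by (auto simp: pred_on.chain_def)
qed

lemma (in noetherian_ring) increasing_ideals_stationary:
  fixes L :: "nat \<Rightarrow> 'a set"
  assumes "\<And>n. ideal (L n) R" "\<And>m n. m \<le> n \<Longrightarrow> L m \<subseteq> L n"
  shows "\<exists>m. \<forall>n\<ge>m. L n = L m"
proof -
  have ne: "range L \<noteq> {}" by simp
  have "ideal I R" if "I \<in> range L" for I
    using that by (elim rangeE) (simp only: assms(1))
  then obtain m where m: "\<And>Y. Y \<in> range L \<Longrightarrow> L m \<subseteq> Y \<Longrightarrow> Y = L m"
    using bexE[OF ideal_family_maximal[OF ne]] by (metis rangeE)
  have "L n = L m" if "m \<le> n" for n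
    by (rule m[OF rangeI assms(2)[OF that]])
  thus ?thesis by blast
qed

section \<open>Leading coefficients with respect to generators of \<open>J\<close>\<close>

context adic_ring
begin

text \<open>A monomial in \<open>u\<^sub>0, u\<^sub>1, \<dots>\<close> is encoded by the multiset of its indices, so that the
  multiset order serves as a monomial order and inclusion of multisets is divisibility. The
  guard makes the folded function commute on the whole type, not only on the carrier.\<close>

definition mset_mon :: "(nat \<Rightarrow> 'a) \<Rightarrow> nat multiset \<Rightarrow> 'a" where
  "mset_mon u \<beta> = fold_mset (\<lambda>k x. if x \<in> carrier R then u k \<otimes> x else x) \<one> \<beta>"

definition mset_mons :: "nat \<Rightarrow> nat \<Rightarrow> nat multiset set" where
  "mset_mons d n = {\<beta>. size \<beta> = n \<and> set_mset \<beta> \<subseteq> {..<d}}"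

definition lower :: "(nat \<Rightarrow> 'a) \<Rightarrow> nat \<Rightarrow> nat multiset \<Rightarrow> 'a set" where
  "lower u d \<beta> = Idl (mset_mon u ` {\<gamma> \<in> mset_mons d (size \<beta>). \<gamma> < \<beta>})"

text \<open>The leading coefficients at \<open>\<beta>\<close>, as in the proof of Hilbert's basis
  theorem, but taken inside \<open>R\<close>. The monomials in the \<open>u k\<close> may satisfy
  relations, so an element has no well-defined leading term; the colon ideal only asks that some
  expression modulo lower monomials exists.\<close>

definition lead_ideal :: "(nat \<Rightarrow> 'a) \<Rightarrow> nat \<Rightarrow> 'a set \<Rightarrow> nat multiset \<Rightarrow> 'a set" where
  "lead_ideal u d I \<beta> = colon_ideal R (I <+>\<^bsub>R\<^esub> lower u d \<beta>) (mset_mon u \<beta>)"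

context
  fixes u :: "nat \<Rightarrow> 'a"
  assumes u: "\<And>k. u k \<in> J"
begin

lemma u_carr: "u k \<in> carrier R"
  using u ideal_carr[OF ideal_J] by blast

lemma mset_mon_empty: "mset_mon u {#} = \<one>"
  by (simp add: mset_mon_def)

text \<open>Both claims come from one interpretation: the recursion first appears with the guard of
  the fold, the guarded form gives membership in the carrier by induction, and membership then
  removes the guard.\<close>

lemma mset_mon_carr_add: "mset_mon u \<beta> \<in> carrier R \<and> mset_mon u (add_mset k \<beta>) = u k \<otimes> mset_mon u \<beta>"
proof -
  interpret comp_fun_commute "\<lambda>k x. if x \<in> carrier R then u k \<otimes> x else x"
    by standard (auto simp: u_carr m_lcomm fun_eq_iff)
  have add: "mset_mon u (add_mset k \<beta>) = (if mset_mon u \<beta> \<in> carrier R then u k \<otimes> mset_mon u \<beta> else mset_mon u \<beta>)"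
    for k \<beta> by (simp add: mset_mon_def)
  have "mset_mon u \<beta> \<in> carrier R" by (induct \<beta>) (auto simp: mset_mon_empty add u_carr)
  thus ?thesis by (simp add: add)
qed

lemma mset_mon_carr: "mset_mon u \<beta> \<in> carrier R"
  using mset_mon_carr_add by blast

lemma mset_mon_image_carr: "mset_mon u ` S \<subseteq> carrier R"
  using mset_mon_carr by blast

lemma mset_mon_add: "mset_mon u (add_mset k \<beta>) = u k \<otimes> mset_mon u \<beta>"
  using mset_mon_carr_add by blast

lemma mset_mon_P: "mset_mon u \<beta> \<in> P (size \<beta>)"
proof (induct \<beta>)
  case empty
  show ?case unfolding mset_mon_empty size_empty P_0 by (rule one_closed)
next
  case (add k \<beta>)
  have "u k \<in> P (Suc 0)" using u P_1 by blast
  from P_mult[OF this add] show ?case by (simp add: mset_mon_add)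
qed

lemma ideal_lower: "ideal (lower u d \<beta>) R"
  unfolding lower_def by (intro genideal_ideal mset_mon_image_carr)

lemma lower_P: "lower u d \<beta> \<subseteq> P (size \<beta>)"
proof -
  have "mset_mon u \<gamma> \<in> P (size \<beta>)" if "\<gamma> \<in> mset_mons d (size \<beta>)" for \<gamma>
    using mset_mon_P[of \<gamma>] that by (simp add: mset_mons_def)
  hence "mset_mon u ` {\<gamma> \<in> mset_mons d (size \<beta>). \<gamma> < \<beta>} \<subseteq> P (size \<beta>)" by auto
  thus ?thesis unfolding lower_def by (rule genideal_minimal[OF ideal_P])
qed

lemma ideal_lead_ideal: "ideal I R \<Longrightarrow> ideal (lead_ideal u d I \<beta>) R"
  unfolding lead_ideal_def by (rule ideal_colon_ideal[OF add_ideals[OF _ ideal_lower] mset_mon_carr])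

lemma u_mult_lower:
  assumes "k < d" "x \<in> lower u d \<beta>"
  shows "u k \<otimes> x \<in> lower u d (add_mset k \<beta>)"
proof (rule genideal_mult_subset[OF _ mset_mon_image_carr ideal_lower])
  show "{u k} \<subseteq> carrier R" using u_carr by blast
  show "u k \<in> Idl {u k}" by (rule genideal_self'[OF u_carr])
  show "x \<in> Idl (mset_mon u ` {\<gamma> \<in> mset_mons d (size \<beta>). \<gamma> < \<beta>})" using assms(2) by (simp add: lower_def)
  fix a b assume ab: "a \<in> {u k}" "b \<in> mset_mon u ` {\<gamma> \<in> mset_mons d (size \<beta>). \<gamma> < \<beta>}"
  then obtain \<gamma> where \<gamma>: "b = mset_mon u \<gamma>" "\<gamma> \<in> mset_mons d (size \<beta>)" "\<gamma> < \<beta>" by blast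
  have "add_mset k \<gamma> \<in> mset_mons d (size (add_mset k \<beta>))" "add_mset k \<gamma> < add_mset k \<beta>"
    using \<gamma> assms(1) by (auto simp: mset_mons_def)
  hence "mset_mon u (add_mset k \<gamma>) \<in> lower u d (add_mset k \<beta>)"
    unfolding lower_def by (intro subsetD[OF genideal_self[OF mset_mon_image_carr]]) blast
  thus "a \<otimes> b \<in> lower u d (add_mset k \<beta>)" using ab \<gamma> by (simp add: mset_mon_add)
qed

text \<open>A relation at \<open>\<beta>\<close> is multiplied by \<open>u k\<close>; the multiset
  order is compatible with adding an element, so lower monomials stay lower.\<close>

lemma lead_ideal_add_mset:
  assumes "ideal I R" "k < d"
  shows "lead_ideal u d I \<beta> \<subseteq> lead_ideal u d I (add_mset k \<beta>)"
proof
  fix c assume c: "c \<in> lead_ideal u d I \<beta>"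
  then obtain i l where il: "i \<in> I" "l \<in> lower u d \<beta>" "c \<otimes> mset_mon u \<beta> = i \<oplus> l" "c \<in> carrier R"
    by (auto simp: lead_ideal_def colon_ideal_def set_add_iff)
  have carr: "i \<in> carrier R" "l \<in> carrier R" "mset_mon u \<beta> \<in> carrier R" "u k \<in> carrier R"
    using il assms ideal_carr[OF ideal_lower] ideal_carr mset_mon_carr u_carr by blast+
  have "c \<otimes> mset_mon u (add_mset k \<beta>) = u k \<otimes> (c \<otimes> mset_mon u \<beta>)"
    unfolding mset_mon_add using carr il(4) by algebra
  also have "\<dots> = u k \<otimes> i \<oplus> u k \<otimes> l" unfolding il(3) using carr by algebra
  finally show "c \<in> lead_ideal u d I (add_mset k \<beta>)"
    using il u_mult_lower[OF assms(2) il(2)] ideal.I_l_closed[OF assms(1)] carr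
    by (auto simp: lead_ideal_def colon_ideal_def set_add_iff)
qed

lemma lead_ideal_mono:
  assumes "ideal I R" "\<beta> \<subseteq># \<gamma>" "set_mset \<gamma> \<subseteq> {..<d}"
  shows "lead_ideal u d I \<beta> \<subseteq> lead_ideal u d I \<gamma>"
proof -
  have "set_mset \<delta> \<subseteq> {..<d} \<Longrightarrow> lead_ideal u d I \<beta> \<subseteq> lead_ideal u d I (\<beta> + \<delta>)" for \<delta>
  proof (induct \<delta>)
    case (add k \<delta>)
    have "lead_ideal u d I (\<beta> + \<delta>) \<subseteq> lead_ideal u d I (add_mset k (\<beta> + \<delta>))"
      using add.prems by (intro lead_ideal_add_mset assms(1)) auto
    thus ?case using add by auto
  qed simp
  from this[of "\<gamma> - \<beta>"] show ?thesis using assms(2,3) by (auto dest: in_diffD)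
qed

lemma P_subset_mset_mons:
  assumes "J = Idl (u ` {..<d})"
  shows "P n \<subseteq> Idl (mset_mon u ` mset_mons d n)"
proof (induct n)
  case 0
  have "mset_mon u {#} \<in> Idl (mset_mon u ` mset_mons d 0)"
    by (intro subsetD[OF genideal_self[OF mset_mon_image_carr]]) (auto simp: mset_mons_def)
  thus ?case using ideal.one_imp_carrier[OF genideal_ideal[OF mset_mon_image_carr]]
    unfolding P_0 mset_mon_empty by blast
next
  case (Suc n)
  have T: "ideal (Idl (mset_mon u ` mset_mons d (Suc n))) R" by (intro genideal_ideal mset_mon_image_carr)
  have "a \<otimes> b \<in> Idl (mset_mon u ` mset_mons d (Suc n))" if "a \<in> P n" "b \<in> J" for a b
  proof (rule genideal_mult_subset[OF mset_mon_image_carr _ T])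
    show "u ` {..<d} \<subseteq> carrier R" using u_carr by blast
    show "a \<in> Idl (mset_mon u ` mset_mons d n)" "b \<in> Idl (u ` {..<d})" using that Suc assms by auto
    fix x y assume "x \<in> mset_mon u ` mset_mons d n" "y \<in> u ` {..<d}"
    then obtain \<beta> k where \<beta>: "x = mset_mon u \<beta>" "\<beta> \<in> mset_mons d n" "y = u k" "k < d" by blast
    have "mset_mon u (add_mset k \<beta>) \<in> Idl (mset_mon u ` mset_mons d (Suc n))"
      using \<beta> by (intro subsetD[OF genideal_self[OF mset_mon_image_carr]]) (auto simp: mset_mons_def)
    thus "x \<otimes> y \<in> Idl (mset_mon u ` mset_mons d (Suc n))"
      using \<beta> m_comm[OF mset_mon_carr u_carr] by (simp add: mset_mon_add)
  qed
  thus ?case unfolding P_Suc by (intro ideal_prod_subsetI T)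
qed

text \<open>A division algorithm that lowers the leading monomial of \<open>x\<close>. The set
  \<open>T\<close> is a down-closed set of monomials of degree n + 1, and its greatest element is
  removed in each step by subtracting some \<open>u k \<otimes> i\<close> with \<open>i\<close> in
  \<open>P n \<inter> I\<close>.\<close>

lemma artin_rees_step:
  assumes I: "ideal I R" and T: "finite T" "T \<subseteq> mset_mons d (Suc n)"
    and down: "\<And>\<beta> \<gamma>. \<beta> \<in> T \<Longrightarrow> \<gamma> \<in> mset_mons d (Suc n) \<Longrightarrow> \<gamma> < \<beta> \<Longrightarrow> \<gamma> \<in> T"
    and stab: "\<And>\<beta>. \<beta> \<in> mset_mons d (Suc n) \<Longrightarrow>
                \<exists>k\<in>#\<beta>. lead_ideal u d I (\<beta> - {#k#}) = lead_ideal u d I \<beta>"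
    and x: "x \<in> I" "x \<in> Idl (mset_mon u ` T)"
  shows "x \<in> ideal_prod R J (P n \<inter> I)"
  using T down x
proof (induct T arbitrary: x rule: finite_linorder_max_induct)
  case empty
  have "Idl {} = {\<zero>}" using genideal_minimal[OF zeroideal, of "{}"]
      ideal_zero_closed[OF genideal_ideal[of "{}"]] by auto
  moreover have "ideal (ideal_prod R J (P n \<inter> I)) R"
    by (intro ideal_prod_is_ideal ideal_J i_intersect ideal_P I)
  ultimately show ?case using empty.prems(4) ideal_zero_closed by simp
next
  case (insert \<beta> T)
  have G: "\<beta> \<in> mset_mons d (Suc n)" and sz: "size \<beta> = Suc n" using insert.prems(1) by (auto simp: mset_mons_def)
  \<comment> \<open>Since \<open>\<beta>\<close> is the greatest element of a down-closed set, what
    remains is everything below \<open>\<beta>\<close> in its degree, and the ideal it generates is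
    \<open>lower u d \<beta>\<close>.\<close>
  have "T = {\<gamma> \<in> mset_mons d (size \<beta>). \<gamma> < \<beta>}"
    unfolding sz using insert.prems(1) insert.prems(2)[of \<beta>] insert.hyps(2) by blast
  hence low: "Idl (mset_mon u ` T) = lower u d \<beta>" by (simp add: lower_def)
  obtain l c where lc: "l \<in> lower u d \<beta>" "c \<in> carrier R" "x = l \<oplus> c \<otimes> mset_mon u \<beta>"
    using insert.prems(4) unfolding image_insert genideal_insert_iff[OF mset_mon_image_carr mset_mon_carr] low
    by blast
  have lcarr: "l \<in> carrier R" by (rule ideal_carr[OF ideal_lower lc(1)])
  have carr: "mset_mon u \<beta> \<in> carrier R" by (rule mset_mon_carr)
  have "c \<otimes> mset_mon u \<beta> = x \<oplus> (\<ominus> l)" using lc(2,3) lcarr carr by algebra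
  hence "c \<in> lead_ideal u d I \<beta>" using lc(2) insert.prems(3) ideal_a_inv_closed[OF ideal_lower lc(1)]
    unfolding lead_ideal_def colon_ideal_def set_add_iff by blast
  moreover obtain k where k: "k \<in># \<beta>" "lead_ideal u d I (\<beta> - {#k#}) = lead_ideal u d I \<beta>"
    using stab[OF G] by blast
  \<comment> \<open>Stability moves the leading coefficient to the divisor of degree n. There it
    comes with an element \<open>i\<close> of \<open>I\<close>, which has order n because the
    monomial and the lower part \<open>m\<close> do; \<open>u k \<otimes> i\<close> then has the
    same term at \<open>\<beta>\<close> as \<open>x\<close>.\<close>
  ultimately have "c \<in> lead_ideal u d I (\<beta> - {#k#})" by simp
  then obtain i m where im: "i \<in> I" "m \<in> lower u d (\<beta> - {#k#})"
      "c \<otimes> mset_mon u (\<beta> - {#k#}) = i \<oplus> m"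
    by (auto simp: lead_ideal_def colon_ideal_def set_add_iff)
  have kd: "k < d" using k(1) G by (auto simp: mset_mons_def)
  have size': "size (\<beta> - {#k#}) = n" using k sz by (simp add: size_Diff_singleton)
  have mon\<beta>: "mset_mon u \<beta> = u k \<otimes> mset_mon u (\<beta> - {#k#})" using k(1) mset_mon_add[of k "\<beta> - {#k#}"] by simp
  have um: "u k \<otimes> m \<in> lower u d \<beta>" using u_mult_lower[OF kd im(2)] k(1) by simp
  have carr2: "i \<in> carrier R" "m \<in> carrier R" "u k \<in> carrier R" "mset_mon u (\<beta> - {#k#}) \<in> carrier R"
    using im I ideal_carr ideal_carr[OF ideal_lower] u_carr mset_mon_carr by blast+
  have "i = c \<otimes> mset_mon u (\<beta> - {#k#}) \<ominus> m" using im(3) carr2 lc(2) by algebra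
  moreover have "c \<otimes> mset_mon u (\<beta> - {#k#}) \<in> P n" "m \<in> P n"
    using mset_mon_P[of "\<beta> - {#k#}"] lower_P[of d "\<beta> - {#k#}"] im(2) lc(2) ideal.I_l_closed[OF ideal_P]
    by (auto simp: size')
  ultimately have iP: "i \<in> P n" using ideal_a_minus_closed[OF ideal_P] by simp
  have ui: "u k \<otimes> i \<in> ideal_prod R J (P n \<inter> I)" using u iP im(1) by (intro ideal_prod.prod) auto
  have "c \<otimes> mset_mon u \<beta> = u k \<otimes> (c \<otimes> mset_mon u (\<beta> - {#k#}))"
    unfolding mon\<beta> using carr2 lc(2) by algebra
  also have "\<dots> = u k \<otimes> i \<oplus> u k \<otimes> m" unfolding im(3) using carr2 by algebra
  finally have cm: "c \<otimes> mset_mon u \<beta> = u k \<otimes> i \<oplus> u k \<otimes> m" .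
  have xd: "x = (l \<oplus> u k \<otimes> m) \<oplus> u k \<otimes> i" unfolding lc(3) cm using carr2 lcarr by algebra
  have "x \<ominus> u k \<otimes> i = l \<oplus> u k \<otimes> m" unfolding xd using carr2 lcarr by algebra
  moreover have "x \<ominus> u k \<otimes> i \<in> I"
    using insert.prems(3) im(1) carr2 I by (intro ideal_a_minus_closed ideal.I_l_closed)
  moreover have "l \<oplus> u k \<otimes> m \<in> lower u d \<beta>" using lc(1) um ideal_lower by (intro ideal_a_closed)
  moreover have "T \<subseteq> mset_mons d (Suc n)" "\<And>\<beta> \<gamma>. \<beta> \<in> T \<Longrightarrow> \<gamma> \<in> mset_mons d (Suc n) \<Longrightarrow> \<gamma> < \<beta> \<Longrightarrow> \<gamma> \<in> T"
    using insert.prems(1) insert.prems(2) insert.hyps(2) by (blast, metis insert_iff order.asym order.strict_trans)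
  ultimately have "l \<oplus> u k \<otimes> m \<in> ideal_prod R J (P n \<inter> I)"
    using insert.hyps(3)[of "l \<oplus> u k \<otimes> m"] unfolding low by simp
  thus ?case using ui unfolding xd by (rule ideal_prod.sum)
qed

end

end

locale noetherian_adic_ring = adic_ring R J + noetherian_ring R for R (structure) and J
begin

text \<open>The ideals of leading coefficients grow along divisibility. By Dickson's lemma and the
  chain condition every monomial of large degree has a divisor of one degree less with the same
  ideal, which is the hypothesis of the division step.\<close>

lemma artin_rees_exists:
  assumes I: "ideal I R"
  shows "\<exists>c. \<forall>n\<ge>c. P (Suc n) \<inter> I = ideal_prod R J (P n \<inter> I)"
proof -
  obtain A where A: "A \<subseteq> carrier R" "finite A" "J = Idl A" using finetely_gen[OF ideal_J] by blast
  obtain xs where xs: "set xs = A" using finite_list[OF A(2)] by blast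
  define d where "d = length xs"
  \<comment> \<open>The generators are padded with zeros because the monomials require
    \<open>u k \<in> J\<close> for every \<open>k\<close>.\<close>
  define u where "u = (\<lambda>k. if k < d then xs ! k else \<zero>)"
  have uA: "u ` {..<d} = A" unfolding xs[symmetric] set_conv_nth by (auto simp: u_def d_def)
  have u: "u k \<in> J" for k
  proof (cases "k < d")
    case True
    hence "u k \<in> A" using uA by blast
    thus ?thesis using genideal_self[OF A(1)] A(3) by blast
  next
    case False
    thus ?thesis using ideal_zero_closed[OF ideal_J] by (simp add: u_def)
  qed
  have "\<exists>c. \<forall>\<beta>. set_mset \<beta> \<subseteq> {..<d} \<and> size \<beta> > c \<longrightarrow>
          (\<exists>k\<in>#\<beta>. lead_ideal u d I (\<beta> - {#k#}) = lead_ideal u d I \<beta>)"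
  proof (rule ccontr)
    assume "\<not> ?thesis"
    hence "\<forall>c. \<exists>\<beta>. set_mset \<beta> \<subseteq> {..<d} \<and> size \<beta> > c \<and>
        (\<forall>k\<in>#\<beta>. lead_ideal u d I (\<beta> - {#k#}) \<noteq> lead_ideal u d I \<beta>)" by simp
    then obtain s where s: "\<forall>c. set_mset (s c) \<subseteq> {..<d} \<and> size (s c) > c \<and>
        (\<forall>k\<in>#s c. lead_ideal u d I (s c - {#k#}) \<noteq> lead_ideal u d I (s c))"
      by (rule choice[THEN exE])
    have s: "set_mset (s c) \<subseteq> {..<d}" "size (s c) > c"
      "k \<in># s c \<Longrightarrow> lead_ideal u d I (s c - {#k#}) \<noteq> lead_ideal u d I (s c)" for c k
      using s by simp_all
    obtain \<phi> :: "nat \<Rightarrow> nat" where \<phi>': "strict_mono \<phi> \<and> (\<forall>m n. m \<le> n \<longrightarrow> s (\<phi> m) \<subseteq># s (\<phi> n))"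
      by (rule exE[OF multiset_seq_incseq_subseq[OF finite_lessThan s(1)]])
    have \<phi>: "strict_mono \<phi>" "m \<le> n \<Longrightarrow> s (\<phi> m) \<subseteq># s (\<phi> n)" for m n using \<phi>' by simp_all
    have "\<exists>m. \<forall>n\<ge>m. lead_ideal u d I (s (\<phi> n)) = lead_ideal u d I (s (\<phi> m))"
      by (rule increasing_ideals_stationary[OF ideal_lead_ideal[OF u I] lead_ideal_mono[OF u I \<phi>(2) s(1)]])
    then obtain m where m: "\<And>n. n \<ge> m \<Longrightarrow> lead_ideal u d I (s (\<phi> n)) = lead_ideal u d I (s (\<phi> m))"
      by blast
    \<comment> \<open>The degree of \<open>s (\<phi> n)\<close> exceeds \<open>\<phi> n\<close>,
      hence also the degree of \<open>s (\<phi> m)\<close>. So \<open>s (\<phi> m)\<close> is a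
      proper divisor and still divides after some index \<open>k\<close> is removed, which squeezes
      the ideal at the quotient between two equal ideals.\<close>
    define n where "n = m + size (s (\<phi> m))"
    have "size (s (\<phi> n)) > size (s (\<phi> m))"
      using s(2)[of "\<phi> n"] strict_mono_imp_increasing[OF \<phi>(1), of n] by (simp add: n_def)
    hence "\<not> s (\<phi> n) \<subseteq># s (\<phi> m)" by (meson leD size_mset_mono)
    then obtain k where k: "count (s (\<phi> m)) k < count (s (\<phi> n)) k"
      by (meson mset_subset_eqI not_le)
    hence kn: "k \<in># s (\<phi> n)" by (metis count_greater_zero_iff gr_zeroI not_less_zero)
    have sub: "s (\<phi> m) \<subseteq># s (\<phi> n)" using \<phi>(2) by (simp add: n_def)
    have "s (\<phi> m) \<subseteq># s (\<phi> n) - {#k#}"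
    proof (rule mset_subset_eqI)
      fix j show "count (s (\<phi> m)) j \<le> count (s (\<phi> n) - {#k#}) j"
        using k mset_subset_eq_count[OF sub, of j] by (cases "j = k") auto
    qed
    moreover have "set_mset (s (\<phi> n) - {#k#}) \<subseteq> {..<d}" using s(1)[of "\<phi> n"] by (auto dest: in_diffD)
    ultimately have "lead_ideal u d I (s (\<phi> m)) \<subseteq> lead_ideal u d I (s (\<phi> n) - {#k#})"
      by (intro lead_ideal_mono[OF u I])
    moreover have "lead_ideal u d I (s (\<phi> n) - {#k#}) \<subseteq> lead_ideal u d I (s (\<phi> n))"
      by (intro lead_ideal_mono[OF u I] s(1)) simp
    moreover have "lead_ideal u d I (s (\<phi> n)) = lead_ideal u d I (s (\<phi> m))" by (rule m) (simp add: n_def)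
    ultimately show False using s(3)[OF kn] by blast
  qed
  then obtain c where c: "\<And>\<beta>. set_mset \<beta> \<subseteq> {..<d} \<Longrightarrow> size \<beta> > c \<Longrightarrow>
          (\<exists>k\<in>#\<beta>. lead_ideal u d I (\<beta> - {#k#}) = lead_ideal u d I \<beta>)" by blast
  have "P (Suc n) \<inter> I = ideal_prod R J (P n \<inter> I)" if n: "n \<ge> c" for n
  proof
    show "P (Suc n) \<inter> I \<subseteq> ideal_prod R J (P n \<inter> I)"
    proof
      fix x assume x: "x \<in> P (Suc n) \<inter> I"
      show "x \<in> ideal_prod R J (P n \<inter> I)"
      proof (rule artin_rees_step[OF u I, where T = "mset_mons d (Suc n)" and d = d])
        show "finite (mset_mons d (Suc n))" unfolding mset_mons_def by (rule finite_msets_size) simp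
        show "x \<in> Idl (mset_mon u ` mset_mons d (Suc n))"
          using P_subset_mset_mons[where u = u and d = d and n = "Suc n", OF u] uA A(3) x by blast
        show "\<exists>k\<in>#\<beta>. lead_ideal u d I (\<beta> - {#k#}) = lead_ideal u d I \<beta>"
          if "\<beta> \<in> mset_mons d (Suc n)" for \<beta> using that n by (intro c) (auto simp: mset_mons_def)
      qed (use x in auto)
    qed
    show "ideal_prod R J (P n \<inter> I) \<subseteq> P (Suc n) \<inter> I" by (rule ideal_prod_P_inter(2)[OF I])
  qed
  thus ?thesis by blast
qed


end

section \<open>Nakayama's lemma and Krull's intersection theorem\<close>

locale local_adic_ring = noetherian_adic_ring R J for R (structure) and J +
  fixes \<mm>
  assumes local: "local_ring R \<mm>" and proper: "J \<noteq> carrier R"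
begin

lemma proper_ideal_subset_maximal:
  assumes "ideal I R" "I \<noteq> carrier R"
  shows "I \<subseteq> \<mm>"
proof -
  let ?F = "{K. ideal K R \<and> I \<subseteq> K \<and> K \<noteq> carrier R}"
  have "I \<in> ?F" using assms by simp
  hence "?F \<noteq> {}" by blast
  hence "\<exists>M \<in> ?F. \<forall>K \<in> ?F. M \<subseteq> K \<longrightarrow> K = M" by (rule ideal_family_maximal) simp
  then obtain M where "M \<in> ?F" and max: "\<forall>K \<in> ?F. M \<subseteq> K \<longrightarrow> K = M" by (rule bexE)
  hence M: "ideal M R" "I \<subseteq> M" "M \<noteq> carrier R" by auto
  have "maximalideal M R"
  proof (rule maximalidealI[OF M(1)])
    show "carrier R \<noteq> M" using M(3) by blast
    fix K assume K: "ideal K R" "M \<subseteq> K" "K \<subseteq> carrier R"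
    show "K = M \<or> K = carrier R"
    proof (cases "K = carrier R")
      case False
      hence "K \<in> ?F" using K M(2) by auto
      thus ?thesis using max K(2) by simp
    qed simp
  qed
  hence "M = \<mm>" using local by (simp add: local_ring_def)
  thus ?thesis using M(2) by simp
qed

lemma one_minus_unit:
  assumes "j \<in> J"
  shows "\<exists>y \<in> carrier R. y \<otimes> (\<one> \<ominus> j) = \<one>"
proof -
  have j: "j \<in> carrier R" by (rule ideal_carr[OF ideal_J assms])
  hence c: "\<one> \<ominus> j \<in> carrier R" by simp
  have I: "ideal (PIdl (\<one> \<ominus> j)) R" by (rule cgenideal_ideal[OF c])
  have mm: "maximalideal \<mm> R" using local by (simp add: local_ring_def)
  hence mI: "ideal \<mm> R" by (rule maximalideal.axioms(1))
  have "PIdl (\<one> \<ominus> j) = carrier R"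
  proof (rule ccontr)
    assume "PIdl (\<one> \<ominus> j) \<noteq> carrier R"
    hence "PIdl (\<one> \<ominus> j) \<subseteq> \<mm>" by (rule proper_ideal_subset_maximal[OF I])
    hence "\<one> \<ominus> j \<in> \<mm>" using cgenideal_self[OF c] by blast
    moreover have "j \<in> \<mm>" using proper_ideal_subset_maximal[OF ideal_J proper] assms by blast
    ultimately have "(\<one> \<ominus> j) \<oplus> j \<in> \<mm>" by (rule ideal_a_closed[OF mI])
    moreover have "(\<one> \<ominus> j) \<oplus> j = \<one>" using j by algebra
    ultimately have "\<mm> = carrier R" using ideal.one_imp_carrier[OF mI] by simp
    thus False using maximalideal.I_notcarr[OF mm] by simp
  qed
  hence "\<one> \<in> PIdl (\<one> \<ominus> j)" by simp
  then obtain y where "y \<in> carrier R" "\<one> = y \<otimes> (\<one> \<ominus> j)" unfolding cgenideal_def by blast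
  thus ?thesis by (intro bexI[of _ y]) simp_all
qed

text \<open>For \<open>D\<close> maximal among the ideals containing \<open>B\<close> and not containing \<open>C\<close>, an element
  \<open>x \<in> C - D\<close> has \<open>J x \<subseteq> D\<close> since \<open>1 - J\<close> consists of units.\<close>

lemma nakayama:
  assumes B: "ideal B R" and C: "ideal C R"
    and BC: "\<And>x. x \<in> C \<Longrightarrow> \<exists>b \<in> B. \<exists>d \<in> ideal_prod R J C. x = b \<oplus> d"
  shows "C \<subseteq> B"
proof (rule ccontr)
  assume nC: "\<not> C \<subseteq> B"
  let ?F = "{D. ideal D R \<and> B \<subseteq> D \<and> \<not> C \<subseteq> D}"
  have "B \<in> ?F" using nC B by simp
  hence "?F \<noteq> {}" by blast
  hence "\<exists>M \<in> ?F. \<forall>K \<in> ?F. M \<subseteq> K \<longrightarrow> K = M" by (rule ideal_family_maximal) simp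
  then obtain D where "D \<in> ?F" and max: "\<forall>K \<in> ?F. D \<subseteq> K \<longrightarrow> K = D" by (rule bexE)
  hence D: "ideal D R" "B \<subseteq> D" "\<not> C \<subseteq> D" by auto
  have mult: "j \<otimes> x \<in> D" if j: "j \<in> J" and xC: "x \<in> C" for j x
  proof (rule ccontr)
    assume n: "j \<otimes> x \<notin> D"
    have x: "x \<in> carrier R" "j \<in> carrier R" using ideal_carr[OF C xC] ideal_carr[OF ideal_J j] .
    have Dc: "D \<subseteq> carrier R" using ideal_carr[OF D(1)] by blast
    let ?K = "Idl (insert (j \<otimes> x) D)"
    have KI: "ideal ?K R" by (rule genideal_ideal) (use Dc x in simp)
    have DK: "insert (j \<otimes> x) D \<subseteq> ?K" by (rule genideal_self) (use Dc x in simp)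
    have "?K \<noteq> D" using DK n by blast
    hence "?K \<notin> ?F" using max DK by blast
    moreover have "B \<subseteq> ?K" using DK D(2) by blast
    ultimately have "C \<subseteq> ?K" using KI by blast
    hence "x \<in> ?K" using xC by blast
    moreover have "Idl D = D"
      using genideal_minimal[OF D(1) subset_refl] genideal_self[OF Dc] by (rule subset_antisym)
    moreover have "x \<in> ?K \<longleftrightarrow> (\<exists>p\<in>Idl D. \<exists>y\<in>carrier R. x = p \<oplus> y \<otimes> (j \<otimes> x))"
      by (rule genideal_insert_iff[OF Dc]) (use x in simp)
    ultimately obtain p y where p: "p \<in> D" "y \<in> carrier R" "x = p \<oplus> y \<otimes> (j \<otimes> x)" by auto
    have pc: "p \<in> carrier R" using p Dc by blast
    have "y \<otimes> j \<in> J" using ideal.I_l_closed[OF ideal_J j p(2)] .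
    from one_minus_unit[OF this] obtain z where z: "z \<in> carrier R" "z \<otimes> (\<one> \<ominus> y \<otimes> j) = \<one>" by blast
    have "(\<one> \<ominus> y \<otimes> j) \<otimes> x = x \<ominus> y \<otimes> (j \<otimes> x)" using x p(2) by algebra
    also have "\<dots> = p" by (rule a_minus_eqI[OF p(3) pc]) (use x p(2) in simp)
    finally have 1: "(\<one> \<ominus> y \<otimes> j) \<otimes> x = p" .
    have "x = (z \<otimes> (\<one> \<ominus> y \<otimes> j)) \<otimes> x" unfolding z(2) using x by simp
    also have "\<dots> = z \<otimes> ((\<one> \<ominus> y \<otimes> j) \<otimes> x)" using z(1) x p(2) by algebra
    finally have "x = z \<otimes> p" unfolding 1 .
    hence "x \<in> D" using ideal.I_l_closed[OF D(1) p(1) z(1)] by simp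
    from ideal.I_l_closed[OF D(1) this x(2)] show False using n by contradiction
  qed
  have JC: "ideal_prod R J C \<subseteq> D" using mult by (rule ideal_prod_subsetI[OF D(1)])
  have "C \<subseteq> D"
  proof
    fix x assume "x \<in> C"
    then obtain b d where bd: "b \<in> B" "d \<in> ideal_prod R J C" "x = b \<oplus> d" using BC by blast
    have "b \<in> D" "d \<in> D" using bd D(2) JC by auto
    thus "x \<in> D" unfolding bd(3) by (rule ideal_a_closed[OF D(1)])
  qed
  thus False using D(3) by blast
qed

text \<open>Artin--Rees is applied to the intersection \<open>C\<close> of all
  \<open>B + P n\<close>. An element of \<open>C\<close> is b + d with d of order c + 1; then d lies
  in \<open>C\<close> as well, hence in \<open>J C\<close>, and \<open>C\<close> is contained in
  \<open>B + J C\<close>.\<close>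

lemma krull_intersection:
  assumes B: "ideal B R" and x: "\<And>n. \<exists>b\<in>B. \<exists>d\<in>P n. x = b \<oplus> d"
  shows "x \<in> B"
proof -
  have BP: "ideal (B <+>\<^bsub>R\<^esub> P n) R" for n by (intro add_ideals B ideal_P)
  define C where "C = (\<Inter>n. B <+>\<^bsub>R\<^esub> P n)"
  have C: "ideal C R"
  proof (rule ideal_memI)
    show "C \<subseteq> carrier R" unfolding C_def using ideal_carr[OF BP[of 0]] by blast
    show "\<zero> \<in> C" using ideal_zero_closed[OF BP] by (simp add: C_def)
    show "x \<oplus> y \<in> C" if "x \<in> C" "y \<in> C" for x y
      using that ideal_a_closed[OF BP] by (simp add: C_def)
    show "y \<otimes> x \<in> C" if "x \<in> C" "y \<in> carrier R" for x y
      using that ideal.I_l_closed[OF BP] by (simp add: C_def)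
  qed
  obtain c where c: "\<forall>n\<ge>c. P (Suc n) \<inter> C = ideal_prod R J (P n \<inter> C)"
    using artin_rees_exists[OF C] by blast
  have "C \<subseteq> B"
  proof (rule nakayama[OF B C])
    fix z assume z: "z \<in> C"
    hence "z \<in> B <+>\<^bsub>R\<^esub> P (Suc c)" unfolding C_def by blast
    then obtain b d where bd: "b \<in> B" "d \<in> P (Suc c)" "z = b \<oplus> d" by (auto simp only: set_add_iff)
    have carr: "b \<in> carrier R" "d \<in> carrier R" using ideal_carr[OF B bd(1)] P_carr[OF bd(2)] .
    have "b \<in> C" unfolding C_def using subset_set_add(1)[OF B ideal_P] bd(1) by blast
    with z have "z \<ominus> b \<in> C" by (rule ideal_a_minus_closed[OF C])
    moreover have "z \<ominus> b = d" unfolding bd(3) using carr by algebra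
    ultimately have "d \<in> P (Suc c) \<inter> C" using bd(2) by simp
    hence "d \<in> ideal_prod R J (P c \<inter> C)" using c by blast
    hence "d \<in> ideal_prod R J C" using ideal_prod_mono[of J J "P c \<inter> C" C] by blast
    with bd(1,3) show "\<exists>b\<in>B. \<exists>d\<in>ideal_prod R J C. z = b \<oplus> d" by blast
  qed
  moreover have "x \<in> C" unfolding C_def using x by (simp only: set_add_iff INT_iff) blast
  ultimately show ?thesis by blast
qed

end

section \<open>Perturbing one generator\<close>

context cring
begin

text \<open>The ideal \<open>H + V g\<close>. Membership is expressed by a difference, so that what has to be
  checked later are identities valid in every commutative ring.\<close>

definition lin :: "'a set \<Rightarrow> 'a set \<Rightarrow> 'a \<Rightarrow> 'a set" where
  "lin H V g = {x \<in> carrier R. \<exists>w\<in>V. x \<ominus> w \<otimes> g \<in> H}"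

lemma linI: "x \<in> carrier R \<Longrightarrow> w \<in> V \<Longrightarrow> x \<ominus> w \<otimes> g \<in> H \<Longrightarrow> x \<in> lin H V g"
  unfolding lin_def by blast

lemma linE:
  assumes "x \<in> lin H V g"
  obtains w where "x \<in> carrier R" "w \<in> V" "x \<ominus> w \<otimes> g \<in> H"
  using assms unfolding lin_def by blast

lemma colonI: "x \<in> carrier R \<Longrightarrow> x \<otimes> g \<in> K \<Longrightarrow> x \<in> colon_ideal R K g"
  unfolding colon_ideal_def by blast

lemma colonD: "x \<in> colon_ideal R K g \<Longrightarrow> x \<otimes> g \<in> K" "x \<in> colon_ideal R K g \<Longrightarrow> x \<in> carrier R"
  unfolding colon_ideal_def by blast+

lemma ideal_lin:
  assumes H: "ideal H R" and V: "ideal V R" and g: "g \<in> carrier R"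
  shows "ideal (lin H V g) R"
proof (rule ideal_memI)
  show "lin H V g \<subseteq> carrier R" unfolding lin_def by blast
  have "\<zero> \<ominus> \<zero> \<otimes> g \<in> H" using ideal_zero_closed[OF H] g by (simp add: a_minus_def)
  thus "\<zero> \<in> lin H V g" by (rule linI[OF zero_closed ideal_zero_closed[OF V]])
next
  fix x y assume "x \<in> lin H V g" "y \<in> lin H V g"
  then obtain v w where v: "x \<in> carrier R" "v \<in> V" "x \<ominus> v \<otimes> g \<in> H"
    and w: "y \<in> carrier R" "w \<in> V" "y \<ominus> w \<otimes> g \<in> H" by (elim linE)
  have c: "v \<in> carrier R" "w \<in> carrier R" using ideal_carr[OF V v(2)] ideal_carr[OF V w(2)] .
  have "(x \<oplus> y) \<ominus> (v \<oplus> w) \<otimes> g = (x \<ominus> v \<otimes> g) \<oplus> (y \<ominus> w \<otimes> g)" using v(1) w(1) c g by algebra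
  also have "\<dots> \<in> H" by (rule ideal_a_closed[OF H v(3) w(3)])
  finally show "x \<oplus> y \<in> lin H V g"
    by (rule linI[OF a_closed[OF v(1) w(1)] ideal_a_closed[OF V v(2) w(2)]])
next
  fix x y assume "x \<in> lin H V g" and y: "y \<in> carrier R"
  then obtain v where v: "x \<in> carrier R" "v \<in> V" "x \<ominus> v \<otimes> g \<in> H" by (elim linE)
  have c: "v \<in> carrier R" using ideal_carr[OF V v(2)] .
  have "y \<otimes> x \<ominus> (y \<otimes> v) \<otimes> g = y \<otimes> (x \<ominus> v \<otimes> g)" using v(1) c y g by algebra
  also have "\<dots> \<in> H" by (rule ideal.I_l_closed[OF H v(3) y])
  finally show "y \<otimes> x \<in> lin H V g"
    by (rule linI[OF m_closed[OF y v(1)] ideal.I_l_closed[OF V v(2) y]])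
qed

lemma subset_lin:
  assumes H: "ideal H R" and V: "ideal V R" and g: "g \<in> carrier R"
  shows "H \<subseteq> lin H V g"
proof
  fix x assume x: "x \<in> H"
  have "x \<ominus> \<zero> \<otimes> g \<in> H" using x ideal_carr[OF H x] g by (simp add: a_minus_def)
  thus "x \<in> lin H V g" by (rule linI[OF ideal_carr[OF H x] ideal_zero_closed[OF V]])
qed

lemma genideal_insert_lin:
  assumes "S \<subseteq> carrier R" "g \<in> carrier R"
  shows "Idl (insert g S) = lin (Idl S) (carrier R) g"
proof -
  have S: "ideal (Idl S) R" by (rule genideal_ideal[OF assms(1)])
  have "x \<in> Idl (insert g S) \<longleftrightarrow> x \<in> lin (Idl S) (carrier R) g" for x
  proof
    assume "x \<in> Idl (insert g S)"
    then obtain p y where py: "p \<in> Idl S" "y \<in> carrier R" "x = p \<oplus> y \<otimes> g"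
      using genideal_insert_iff[OF assms, of x] by blast
    have p: "p \<in> carrier R" by (rule ideal_carr[OF S py(1)])
    have "x \<ominus> y \<otimes> g = p" by (rule a_minus_eqI[OF py(3) p]) (use py assms in simp)
    thus "x \<in> lin (Idl S) (carrier R) g" using py p assms by (intro linI[of x y]) simp_all
  next
    assume "x \<in> lin (Idl S) (carrier R) g"
    then obtain y where y: "x \<in> carrier R" "y \<in> carrier R" "x \<ominus> y \<otimes> g \<in> Idl S" by (rule linE)
    have "x = (x \<ominus> y \<otimes> g) \<oplus> y \<otimes> g" using y(1,2) assms(2) by algebra
    thus "x \<in> Idl (insert g S)" using genideal_insert_iff[OF assms, of x] y(2,3) by blast
  qed
  thus ?thesis by blast
qed

end

context adic_ring
begin

definition kills :: "nat \<Rightarrow> 'a set \<Rightarrow> 'a set \<Rightarrow> bool" where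
  "kills n A B \<longleftrightarrow> (\<forall>u\<in>P n. \<forall>x\<in>A. u \<otimes> x \<in> B)"

text \<open>The form in which Artin--Rees is used. It follows from an Artin--Rees number strictly
  below \<open>N\<close>, and the strictness is responsible for \<open>Suc k\<close> in place of
  \<open>k\<close>.\<close>

definition ar_bound :: "'a set \<Rightarrow> nat \<Rightarrow> bool" where
  "ar_bound I N \<longleftrightarrow> (\<forall>k. P (N + k) \<inter> I \<subseteq> ideal_prod R (P (Suc k)) I)"

text \<open>Inclusion of the initial ideal of \<open>I\<close> in that of \<open>I'\<close>.\<close>

definition in_sub :: "'a set \<Rightarrow> 'a set \<Rightarrow> bool" where
  "in_sub I I' \<longleftrightarrow> (\<forall>n. \<forall>x \<in> I \<inter> P n. \<exists>x'\<in>I'. x \<ominus> x' \<in> P (Suc n))"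

lemma P_antimonoD: "m \<le> n \<Longrightarrow> x \<in> P n \<Longrightarrow> x \<in> P m"
  using P_antimono by blast

lemma killsD: "kills n A B \<Longrightarrow> u \<in> P n \<Longrightarrow> x \<in> A \<Longrightarrow> u \<otimes> x \<in> B"
  unfolding kills_def by blast

lemma kills_mono: "kills n A B \<Longrightarrow> n \<le> m \<Longrightarrow> kills m A B"
  unfolding kills_def using P_antimono[of n m] by blast

text \<open>Reduces a multiplier from \<open>P (m + n)\<close> to a product of two factors that can
  be treated one after the other.\<close>

lemma P_prod_mult_closed:
  assumes "ideal Y R" "x \<in> carrier R" "w \<in> P (m + n)"
    and "\<And>t u. t \<in> P m \<Longrightarrow> u \<in> P n \<Longrightarrow> (t \<otimes> u) \<otimes> x \<in> Y"
  shows "w \<otimes> x \<in> Y"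
proof -
  have "ideal_prod R (P m) (P n) \<subseteq> colon_ideal R Y x"
  proof (rule ideal_prod_subsetI[OF ideal_colon_ideal[OF assms(1,2)]])
    fix t u assume "t \<in> P m" "u \<in> P n"
    thus "t \<otimes> u \<in> colon_ideal R Y x" using assms(4) P_carr by (intro colonI m_closed)
  qed
  thus ?thesis using assms(3) colonD(1) unfolding P_add by blast
qed

text \<open>The factor of \<open>J\<close> for k = 0 is split off at the exponent N - 1, which is
  still at least \<open>c\<close>; each further exponent contributes one more factor.\<close>

lemma artin_rees_imp_ar_bound:
  assumes I: "ideal I R" and c: "\<forall>n\<ge>c. P (Suc n) \<inter> I = ideal_prod R J (P n \<inter> I)" and "c < N"
  shows "ar_bound I N"
  unfolding ar_bound_def
proof
  fix k show "P (N + k) \<inter> I \<subseteq> ideal_prod R (P (Suc k)) I"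
  proof (induct k)
    case 0
    have "P (Suc (N - 1)) \<inter> I = ideal_prod R J (P (N - 1) \<inter> I)" by (rule c[rule_format]) (use assms(3) in simp)
    moreover have "Suc (N - 1) = N + 0" using assms(3) by simp
    moreover have "ideal_prod R J (P (N - 1) \<inter> I) \<subseteq> ideal_prod R J I" by (rule ideal_prod_mono) simp_all
    ultimately show ?case unfolding P_1 by metis
  next
    case (Suc k)
    have "P (Suc (N + k)) \<inter> I = ideal_prod R J (P (N + k) \<inter> I)"
      using c assms(3) by (metis less_imp_le_nat trans_le_add1)
    also have "\<dots> \<subseteq> ideal_prod R J (ideal_prod R (P (Suc k)) I)"
      by (rule ideal_prod_mono[OF subset_refl Suc])
    also have "\<dots> = ideal_prod R (ideal_prod R J (P (Suc k))) I"
      by (rule ideal_prod_assoc[OF ideal_J ideal_P I, symmetric])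
    also have "ideal_prod R J (P (Suc k)) = P (Suc (Suc k))"
      using P_add[of "Suc 0" "Suc k"] unfolding P_1 by simp
    finally show ?case by simp
  qed
qed

text \<open>Exchanges \<open>g\<close> and \<open>h\<close>. If y g = x h modulo \<open>H\<close>,
  then x lies in \<open>(H + (g)) : h\<close>, so u x = v g modulo \<open>H\<close> for u of order
  c. Substituting, u y - v h lies in \<open>H : g\<close>, and a factor of order A moves it into
  \<open>H\<close>.\<close>

lemma kills_colon_step:
  assumes H: "ideal H R" and g: "g \<in> carrier R" and h: "h \<in> carrier R"
    and kA: "kills A (colon_ideal R H g) H"
    and kc: "kills c (colon_ideal R (lin H (carrier R) g) h) (lin H (carrier R) g)"
  shows "kills (A + c) (colon_ideal R (lin H (carrier R) h) g) (lin H (carrier R) h)"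
  unfolding kills_def
proof (intro ballI)
  let ?K = "lin H (carrier R) h"
  have KI: "ideal ?K R" by (rule ideal_lin[OF H oneideal h])
  fix w y assume w: "w \<in> P (A + c)" and "y \<in> colon_ideal R ?K g"
  hence y: "y \<in> carrier R" "y \<otimes> g \<in> ?K" using colonD by blast+
  obtain x where x: "x \<in> carrier R" "y \<otimes> g \<ominus> x \<otimes> h \<in> H" using y(2) by (rule linE)
  have "x \<otimes> h \<ominus> y \<otimes> g = \<ominus> (y \<otimes> g \<ominus> x \<otimes> h)" using x(1) y(1) g h by algebra
  also have "\<dots> \<in> H" by (rule ideal_a_inv_closed[OF H x(2)])
  finally have "x \<otimes> h \<ominus> y \<otimes> g \<in> H" .
  hence "x \<otimes> h \<in> lin H (carrier R) g" using x(1) y(1) h by (intro linI[of _ y]) simp_all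
  hence xc: "x \<in> colon_ideal R (lin H (carrier R) g) h" by (rule colonI[OF x(1)])
  show "w \<otimes> y \<in> ?K"
  proof (rule P_prod_mult_closed[OF KI y(1) w])
    fix t u assume t: "t \<in> P A" and u: "u \<in> P c"
    have c: "t \<in> carrier R" "u \<in> carrier R" using P_carr t u by blast+
    obtain v where v: "v \<in> carrier R" "u \<otimes> x \<ominus> v \<otimes> g \<in> H"
      using killsD[OF kc u xc] by (rule linE)
    have "(u \<otimes> y \<ominus> v \<otimes> h) \<otimes> g = u \<otimes> (y \<otimes> g \<ominus> x \<otimes> h) \<oplus> h \<otimes> (u \<otimes> x \<ominus> v \<otimes> g)"
      using c x(1) y(1) v(1) g h by algebra
    also have "\<dots> \<in> H"
      by (rule ideal_a_closed[OF H ideal.I_l_closed[OF H x(2) c(2)] ideal.I_l_closed[OF H v(2) h]])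
    finally have "u \<otimes> y \<ominus> v \<otimes> h \<in> colon_ideal R H g"
      using c y(1) v(1) h by (intro colonI) simp_all
    hence "t \<otimes> (u \<otimes> y \<ominus> v \<otimes> h) \<in> H" by (rule killsD[OF kA t])
    moreover have "t \<otimes> (u \<otimes> y \<ominus> v \<otimes> h) = (t \<otimes> u) \<otimes> y \<ominus> (t \<otimes> v) \<otimes> h"
      using c y(1) v(1) h by algebra
    ultimately show "(t \<otimes> u) \<otimes> y \<in> ?K"
      using c y(1) v(1) by (intro linI[of _ "t \<otimes> v"]) simp_all
  qed
qed

text \<open>The Artin--Rees bound provides an expression of \<open>x\<close> modulo \<open>K\<close>
  with coefficient of order k + 1. It and \<open>y\<close> are coefficients of \<open>g\<close> for
  the same element modulo \<open>K\<close>, so they differ by an element of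
  \<open>K : g\<close>.\<close>

lemma ar_bound_lin:
  assumes K: "ideal K R" and g: "g \<in> carrier R" and ar: "ar_bound (lin K (carrier R) g) N"
    and x: "x \<in> P (N + k)" and y: "y \<in> carrier R" and xy: "x \<ominus> y \<otimes> g \<in> K"
  shows "\<exists>y1\<in>P (Suc k). y \<ominus> y1 \<in> colon_ideal R K g"
proof -
  have LI: "ideal (lin K (P (Suc k)) g) R" by (rule ideal_lin[OF K ideal_P g])
  have xc: "x \<in> carrier R" by (rule P_carr[OF x])
  have "x \<in> lin K (carrier R) g" by (rule linI[OF xc y xy])
  hence "x \<in> ideal_prod R (P (Suc k)) (lin K (carrier R) g)" using ar x unfolding ar_bound_def by blast
  also have "\<dots> \<subseteq> lin K (P (Suc k)) g"
  proof (rule ideal_prod_subsetI[OF LI])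
    fix t a assume t: "t \<in> P (Suc k)" and "a \<in> lin K (carrier R) g"
    then obtain w where w: "a \<in> carrier R" "w \<in> carrier R" "a \<ominus> w \<otimes> g \<in> K" by (elim linE)
    have tc: "t \<in> carrier R" by (rule P_carr[OF t])
    have "t \<otimes> a \<ominus> (t \<otimes> w) \<otimes> g = t \<otimes> (a \<ominus> w \<otimes> g)" using w(1,2) tc g by algebra
    also have "\<dots> \<in> K" by (rule ideal.I_l_closed[OF K w(3) tc])
    finally show "t \<otimes> a \<in> lin K (P (Suc k)) g"
      by (rule linI[OF m_closed[OF tc w(1)] ideal.I_r_closed[OF ideal_P t w(2)]])
  qed
  finally obtain y1 where y1: "y1 \<in> P (Suc k)" "x \<ominus> y1 \<otimes> g \<in> K" by (rule linE)
  have c: "y1 \<in> carrier R" by (rule P_carr[OF y1(1)])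
  have "(y \<ominus> y1) \<otimes> g = (x \<ominus> y1 \<otimes> g) \<ominus> (x \<ominus> y \<otimes> g)" using c y xc g by algebra
  also have "\<dots> \<in> K" by (rule ideal_a_minus_closed[OF K y1(2) xy])
  finally have "y \<ominus> y1 \<in> colon_ideal R K g" using c y by (intro colonI) simp_all
  thus ?thesis using y1(1) by blast
qed

context
  fixes K g \<epsilon> N
  assumes K: "ideal K R" and g: "g \<in> carrier R" and eps: "\<epsilon> \<in> P N"
    and ar: "ar_bound (lin K (carrier R) g) N" and kN: "kills N (colon_ideal R K g) K"
begin

lemma eps_carr: "\<epsilon> \<in> carrier R" by (rule P_carr[OF eps])

lemma eps_colon: "s \<in> colon_ideal R K g \<Longrightarrow> \<epsilon> \<otimes> s \<in> K" by (rule killsD[OF kN eps])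

lemma lin_perturb_in_sub: "in_sub (lin K (carrier R) g) (lin K (carrier R) (g \<oplus> \<epsilon>))"
  unfolding in_sub_def
proof (intro allI ballI)
  fix n x assume x: "x \<in> lin K (carrier R) g \<inter> P n"
  then obtain y where y: "x \<in> carrier R" "y \<in> carrier R" "x \<ominus> y \<otimes> g \<in> K" by (auto elim: linE)
  \<comment> \<open>The exponent is what makes \<open>y1 \<otimes> \<epsilon>\<close> have order n +
    1. For n < N the truncated difference is 0 and any coefficient will do.\<close>
  have "\<exists>y1\<in>P (Suc n - N). x \<ominus> y1 \<otimes> g \<in> K"
  proof (cases "n < N")
    case True
    hence "y \<in> P (Suc n - N)" using y(2) P_0 by (simp add: Suc_leI)
    thus ?thesis using y(3) by blast
  next
    case False
    then obtain k where k: "n = N + k" by (metis le_add_diff_inverse not_less)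
    have "x \<in> P (N + k)" using x k by simp
    then obtain y1 where y1: "y1 \<in> P (Suc k)" "y \<ominus> y1 \<in> colon_ideal R K g"
      using ar_bound_lin[OF K g ar _ y(2,3)] by blast
    have c: "y1 \<in> carrier R" by (rule P_carr[OF y1(1)])
    have "x \<ominus> y1 \<otimes> g = (x \<ominus> y \<otimes> g) \<oplus> (y \<ominus> y1) \<otimes> g" using c y(1,2) g by algebra
    also have "\<dots> \<in> K" by (rule ideal_a_closed[OF K y(3) colonD(1)[OF y1(2)]])
    finally show ?thesis using y1(1) k by (intro bexI[of _ y1]) simp_all
  qed
  then obtain y1 where y1: "y1 \<in> P (Suc n - N)" "x \<ominus> y1 \<otimes> g \<in> K" by blast
  have c: "y1 \<in> carrier R" by (rule P_carr[OF y1(1)])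
  have "(x \<oplus> y1 \<otimes> \<epsilon>) \<ominus> y1 \<otimes> (g \<oplus> \<epsilon>) = x \<ominus> y1 \<otimes> g" using c y(1) g eps_carr by algebra
  hence "x \<oplus> y1 \<otimes> \<epsilon> \<in> lin K (carrier R) (g \<oplus> \<epsilon>)"
    using y1(2) c y(1) eps_carr by (intro linI[of _ y1]) simp_all
  moreover have "y1 \<otimes> \<epsilon> \<in> P (Suc n)"
    by (rule P_antimonoD[OF _ P_mult[OF y1(1) eps]]) simp
  hence "\<ominus> (y1 \<otimes> \<epsilon>) \<in> P (Suc n)" by (rule ideal_a_inv_closed[OF ideal_P])
  moreover have "x \<ominus> (x \<oplus> y1 \<otimes> \<epsilon>) = \<ominus> (y1 \<otimes> \<epsilon>)" using c y(1) eps_carr by algebra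
  ultimately show "\<exists>x'\<in>lin K (carrier R) (g \<oplus> \<epsilon>). x \<ominus> x' \<in> P (Suc n)" by metis
qed

text \<open>The Artin--Rees bound is available for \<open>K + (g)\<close> only, so the order of the
  coefficient z of \<open>g \<oplus> \<epsilon>\<close> is raised by one at a time. As long as z
  \<epsilon> has order m, so has x - z \<epsilon>, which equals z g modulo \<open>K\<close>; the
  bound then improves z up to an element of \<open>K : g\<close>, which \<epsilon> multiplies into
  \<open>K\<close>.\<close>

lemma lin_perturb_in_sub_rev: "in_sub (lin K (carrier R) (g \<oplus> \<epsilon>)) (lin K (carrier R) g)"
  unfolding in_sub_def
proof (intro allI ballI)
  fix n x assume x: "x \<in> lin K (carrier R) (g \<oplus> \<epsilon>) \<inter> P n"
  then obtain y where y: "x \<in> carrier R" "y \<in> carrier R" "x \<ominus> y \<otimes> (g \<oplus> \<epsilon>) \<in> K" by (auto elim: linE)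
  have "m \<le> Suc n \<Longrightarrow> \<exists>y1\<in>P (m - N). x \<ominus> y1 \<otimes> (g \<oplus> \<epsilon>) \<in> K" for m
  proof (induct m)
    case 0
    have "y \<in> P (0 - N)" using y(2) P_0 by simp
    thus ?case using y(3) by blast
  next
    case (Suc m)
    then obtain z where z: "z \<in> P (m - N)" "x \<ominus> z \<otimes> (g \<oplus> \<epsilon>) \<in> K" by auto
    have zc: "z \<in> carrier R" by (rule P_carr[OF z(1)])
    show ?case
    proof (cases "m < N")
      case True
      hence "z \<in> P (Suc m - N)" using zc P_0 by (simp add: Suc_leI)
      thus ?thesis using z(2) by blast
    next
      case False
      then obtain k where k: "m = N + k" by (metis le_add_diff_inverse not_less)
      have xm: "x \<in> P m" using x Suc.prems P_antimono[of m n] by auto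
      have "z \<otimes> \<epsilon> \<in> P m" using P_mult[OF z(1) eps] k by (simp add: add.commute)
      hence "x \<ominus> z \<otimes> \<epsilon> \<in> P (N + k)" using ideal_a_minus_closed[OF ideal_P xm] k by simp
      moreover have e: "(x \<ominus> z \<otimes> \<epsilon>) \<ominus> z \<otimes> g = x \<ominus> z \<otimes> (g \<oplus> \<epsilon>)"
        using zc y(1) g eps_carr by algebra
      have "(x \<ominus> z \<otimes> \<epsilon>) \<ominus> z \<otimes> g \<in> K" unfolding e by (rule z(2))
      ultimately obtain y1 where y1: "y1 \<in> P (Suc k)" "z \<ominus> y1 \<in> colon_ideal R K g"
        using ar_bound_lin[OF K g ar _ zc] by blast
      have c: "y1 \<in> carrier R" by (rule P_carr[OF y1(1)])
      have "x \<ominus> y1 \<otimes> (g \<oplus> \<epsilon>) =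
          (x \<ominus> z \<otimes> (g \<oplus> \<epsilon>)) \<oplus> ((z \<ominus> y1) \<otimes> g \<oplus> \<epsilon> \<otimes> (z \<ominus> y1))"
        using c zc y(1) g eps_carr by algebra
      also have "\<dots> \<in> K"
        by (rule ideal_a_closed[OF K z(2) ideal_a_closed[OF K colonD(1)[OF y1(2)] eps_colon[OF y1(2)]]])
      finally show ?thesis using y1(1) k by (intro bexI[of _ y1]) simp_all
    qed
  qed
  from this[OF le_refl] obtain y1 where y1: "y1 \<in> P (Suc n - N)" "x \<ominus> y1 \<otimes> (g \<oplus> \<epsilon>) \<in> K" by blast
  have c: "y1 \<in> carrier R" by (rule P_carr[OF y1(1)])
  have "(x \<ominus> y1 \<otimes> \<epsilon>) \<ominus> y1 \<otimes> g = x \<ominus> y1 \<otimes> (g \<oplus> \<epsilon>)" using c y(1) g eps_carr by algebra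
  hence "x \<ominus> y1 \<otimes> \<epsilon> \<in> lin K (carrier R) g"
    using y1(2) c y(1) eps_carr by (intro linI[of _ y1]) simp_all
  moreover have "y1 \<otimes> \<epsilon> \<in> P (Suc n)"
    by (rule P_antimonoD[OF _ P_mult[OF y1(1) eps]]) simp
  moreover have "x \<ominus> (x \<ominus> y1 \<otimes> \<epsilon>) = y1 \<otimes> \<epsilon>" using c y(1) eps_carr by algebra
  ultimately show "\<exists>x'\<in>lin K (carrier R) g. x \<ominus> x' \<in> P (Suc n)" by metis
qed

lemma colon_perturb_superset: "colon_ideal R K g \<subseteq> colon_ideal R K (g \<oplus> \<epsilon>)"
proof
  fix s assume s: "s \<in> colon_ideal R K g"
  have "s \<otimes> (g \<oplus> \<epsilon>) = s \<otimes> g \<oplus> \<epsilon> \<otimes> s" using colonD(2)[OF s] g eps_carr by algebra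
  also have "\<dots> \<in> K" by (rule ideal_a_closed[OF K colonD(1)[OF s] eps_colon[OF s]])
  finally show "s \<in> colon_ideal R K (g \<oplus> \<epsilon>)" by (rule colonI[OF colonD(2)[OF s]])
qed

text \<open>If z approximates y modulo \<open>K : g\<close>, then \<epsilon> (y - z) is in
  \<open>K\<close>, so y g equals - z \<epsilon> modulo \<open>K\<close>. That element has order N +
  k, whence a coefficient of order k + 1.\<close>

lemma colon_perturb_approx:
  assumes y: "y \<in> colon_ideal R K (g \<oplus> \<epsilon>)"
  shows "\<exists>y1\<in>P k. y \<ominus> y1 \<in> colon_ideal R K g"
proof (induct k)
  have yc: "y \<in> carrier R" by (rule colonD(2)[OF y])
  case 0
  have "y \<ominus> y = \<zero>" using yc by algebra
  hence "y \<ominus> y \<in> colon_ideal R K g" using ideal_zero_closed[OF ideal_colon_ideal[OF K g]] by simp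
  moreover have "y \<in> P 0" unfolding P_0 by (rule yc)
  ultimately show ?case by blast
next
  have yc: "y \<in> carrier R" by (rule colonD(2)[OF y])
  case (Suc k)
  then obtain z where z: "z \<in> P k" "y \<ominus> z \<in> colon_ideal R K g" by blast
  have zc: "z \<in> carrier R" by (rule P_carr[OF z(1)])
  have "z \<otimes> \<epsilon> \<in> P (N + k)" using P_mult[OF z(1) eps] by (simp add: add.commute)
  hence "\<ominus> (z \<otimes> \<epsilon>) \<in> P (N + k)" by (rule ideal_a_inv_closed[OF ideal_P])
  moreover have "\<ominus> (z \<otimes> \<epsilon>) \<ominus> y \<otimes> g = \<epsilon> \<otimes> (y \<ominus> z) \<ominus> y \<otimes> (g \<oplus> \<epsilon>)"
    using zc yc g eps_carr by algebra
  moreover have "\<epsilon> \<otimes> (y \<ominus> z) \<ominus> y \<otimes> (g \<oplus> \<epsilon>) \<in> K"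
    by (rule ideal_a_minus_closed[OF K eps_colon[OF z(2)] colonD(1)[OF y]])
  ultimately show ?case using ar_bound_lin[OF K g ar _ yc] by metis
qed

end

end

context local_adic_ring
begin

lemma colon_perturb_eq:
  assumes K: "ideal K R" and g: "g \<in> carrier R" and eps: "\<epsilon> \<in> P N"
    and ar: "ar_bound (lin K (carrier R) g) N" and kN: "kills N (colon_ideal R K g) K"
  shows "colon_ideal R K (g \<oplus> \<epsilon>) = colon_ideal R K g"
proof
  show "colon_ideal R K g \<subseteq> colon_ideal R K (g \<oplus> \<epsilon>)" by (rule colon_perturb_superset[OF K g eps ar kN])
  show "colon_ideal R K (g \<oplus> \<epsilon>) \<subseteq> colon_ideal R K g"
  proof
    fix y assume y: "y \<in> colon_ideal R K (g \<oplus> \<epsilon>)"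
    show "y \<in> colon_ideal R K g"
    proof (rule krull_intersection[OF ideal_colon_ideal[OF K g]])
      fix n
      obtain z where z: "z \<in> P n" "y \<ominus> z \<in> colon_ideal R K g"
        using colon_perturb_approx[OF K g eps ar kN y, of n] by blast
      have "y = (y \<ominus> z) \<oplus> z" using colonD(2)[OF y] P_carr[OF z(1)] by algebra
      thus "\<exists>b\<in>colon_ideal R K g. \<exists>d\<in>P n. y = b \<oplus> d" using z by blast
    qed
  qed
qed


text \<open>A relation \<open>x h = p + y (g + \<epsilon>)\<close> with \<open>p \<in> H\<close> is compared with a relation
  \<open>y g = p' + x\<^sub>1 h\<close>, which exists because \<open>(H + (h)) : (g + \<epsilon>) = (H + (h)) : g\<close>. If
  \<open>\<epsilon> = \<Sum> u\<^sub>l t\<^sub>l\<close> with \<open>u\<^sub>l\<close> of order \<open>c\<close> and \<open>u\<^sub>l x\<^sub>1 \<equiv> v\<^sub>l g\<close> modulo \<open>H\<close>, then for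
  \<open>z = \<Sum> t\<^sub>l v\<^sub>l\<close> the element \<open>x\<^sub>1 + z\<close> is multiplied into \<open>H + (g + \<epsilon>)\<close>, and
  \<open>x - x\<^sub>1 - z\<close> lies in \<open>H : h\<close>. On \<open>H : h\<close> the error is in \<open>\<epsilon> V\<close> for \<open>V = H : g h\<close>, and
  \<open>\<epsilon> V \<subseteq> H + (g + \<epsilon>) + J \<epsilon> V\<close>.\<close>

lemma kills_perturb:
  assumes H: "ideal H R" and g: "g \<in> carrier R" and h: "h \<in> carrier R" and eps: "\<epsilon> \<in> P N"
    and kA: "kills A (colon_ideal R H g) H"
    and kc: "kills c (colon_ideal R (lin H (carrier R) g) h) (lin H (carrier R) g)"
    and N: "A + c < N" and ar: "ar_bound (lin (lin H (carrier R) h) (carrier R) g) N"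
  shows "kills c (colon_ideal R (lin H (carrier R) (g \<oplus> \<epsilon>)) h) (lin H (carrier R) (g \<oplus> \<epsilon>))"
proof -
  let ?I = "lin H (carrier R) g" and ?I' = "lin H (carrier R) (g \<oplus> \<epsilon>)"
  let ?K = "lin H (carrier R) h" and ?V = "colon_ideal R H (g \<otimes> h)"
  have e: "\<epsilon> \<in> carrier R" by (rule P_carr[OF eps])
  have g': "g \<oplus> \<epsilon> \<in> carrier R" using g e by simp
  have II: "ideal ?I R" by (rule ideal_lin[OF H oneideal g])
  have II': "ideal ?I' R" by (rule ideal_lin[OF H oneideal g'])
  have KI: "ideal ?K R" by (rule ideal_lin[OF H oneideal h])
  have VI: "ideal ?V R" by (rule ideal_colon_ideal[OF H m_closed[OF g h]])
  have JV: "ideal (ideal_prod R J ?V) R" by (rule ideal_prod_is_ideal[OF ideal_J VI])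
  have HI: "H \<subseteq> ?I" by (rule subset_lin[OF H oneideal g])
  have HI': "H \<subseteq> ?I'" by (rule subset_lin[OF H oneideal g'])

  \<comment> \<open>The point is that the coefficient lies in \<open>?V\<close>: multiplying by h
    annihilates q modulo \<open>H\<close>, hence also v g. This allows the step to be
    iterated.\<close>
  have lift: "\<exists>v\<in>?V. u \<otimes> q \<ominus> v \<otimes> g \<in> H"
    if u: "u \<in> P c" and q: "q \<in> colon_ideal R H h" for u q
  proof -
    have c: "u \<in> carrier R" "q \<in> carrier R" using P_carr[OF u] colonD(2)[OF q] .
    have "q \<in> colon_ideal R ?I h" using colonD(1)[OF q] HI by (intro colonI[OF c(2)]) blast
    from killsD[OF kc u this] obtain v where v: "v \<in> carrier R" "u \<otimes> q \<ominus> v \<otimes> g \<in> H" by (rule linE)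
    have "v \<otimes> (g \<otimes> h) = u \<otimes> (q \<otimes> h) \<ominus> h \<otimes> (u \<otimes> q \<ominus> v \<otimes> g)" using c v(1) g h by algebra
    also have "\<dots> \<in> H"
      by (rule ideal_a_minus_closed[OF H ideal.I_l_closed[OF H colonD(1)[OF q] c(1)] ideal.I_l_closed[OF H v(2) h]])
    finally have "v \<in> ?V" by (rule colonI[OF v(1)])
    thus ?thesis using v(2) by blast
  qed

  \<comment> \<open>For v in \<open>?V\<close> the element v h lies in \<open>H : g\<close>, so a
    factor t of order A takes v into \<open>H : h\<close>, where \<open>lift\<close>
    applies.\<close>
  have V1: "w \<otimes> v \<in> lin H ?V g" if w: "w \<in> P (A + c)" and v: "v \<in> ?V" for w v
  proof (rule P_prod_mult_closed[OF ideal_lin[OF H VI g] colonD(2)[OF v] w])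
    have vc: "v \<in> carrier R" by (rule colonD(2)[OF v])
    fix t u assume t: "t \<in> P A" and u: "u \<in> P c"
    have c: "t \<in> carrier R" "u \<in> carrier R" using P_carr t u by blast+
    have "(v \<otimes> h) \<otimes> g = v \<otimes> (g \<otimes> h)" using vc g h by algebra
    hence "v \<otimes> h \<in> colon_ideal R H g" using colonD(1)[OF v] vc h by (intro colonI) simp_all
    hence "t \<otimes> (v \<otimes> h) \<in> H" by (rule killsD[OF kA t])
    hence "t \<otimes> v \<in> colon_ideal R H h" using c vc h by (intro colonI) (simp_all add: m_assoc)
    from lift[OF u this] obtain z where z: "z \<in> ?V" "u \<otimes> (t \<otimes> v) \<ominus> z \<otimes> g \<in> H" by blast
    have "(t \<otimes> u) \<otimes> v = u \<otimes> (t \<otimes> v)" using c vc by algebra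
    thus "(t \<otimes> u) \<otimes> v \<in> lin H ?V g" using z c vc by (intro linI[of _ z]) simp_all
  qed

  obtain k where k: "N = Suc k + (A + c)" using N by (metis add.commute add_Suc_right less_imp_Suc_add)
  \<comment> \<open>As A + c < N, at least one factor of \<open>J\<close> is left over and passes to
    the coefficient of \<open>g\<close>; Nakayama's lemma needs precisely this.\<close>
  have V2: "\<epsilon> \<otimes> v \<in> lin H (ideal_prod R J ?V) g" if v: "v \<in> ?V" for v
  proof (rule P_prod_mult_closed[OF ideal_lin[OF H JV g] colonD(2)[OF v] eps[unfolded k]])
    have vc: "v \<in> carrier R" by (rule colonD(2)[OF v])
    fix t u assume t: "t \<in> P (Suc k)" and u: "u \<in> P (A + c)"
    have c: "t \<in> carrier R" "u \<in> carrier R" using P_carr t u by blast+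
    have tJ: "t \<in> J" using P_antimonoD[of "Suc 0", OF _ t] unfolding P_1 by simp
    obtain w where w: "w \<in> ?V" "u \<otimes> v \<ominus> w \<otimes> g \<in> H" using V1[OF u v] by (rule linE)
    have wc: "w \<in> carrier R" by (rule colonD(2)[OF w(1)])
    have "(t \<otimes> u) \<otimes> v \<ominus> (t \<otimes> w) \<otimes> g = t \<otimes> (u \<otimes> v \<ominus> w \<otimes> g)" using c vc wc g by algebra
    also have "\<dots> \<in> H" by (rule ideal.I_l_closed[OF H w(2) c(1)])
    finally show "(t \<otimes> u) \<otimes> v \<in> lin H (ideal_prod R J ?V) g"
      using c vc ideal_prod.prod[OF tJ w(1)] by (intro linI[of _ "t \<otimes> w"]) simp_all
  qed

  define C where "C = (\<lambda>v. \<epsilon> \<otimes> v) ` ?V"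
  have C: "ideal C R"
  proof (rule ideal_memI)
    show "C \<subseteq> carrier R" unfolding C_def using e colonD(2) by (intro image_subsetI m_closed)
    show "\<zero> \<in> C" unfolding C_def using ideal_zero_closed[OF VI] e by (intro image_eqI[of _ _ \<zero>]) simp_all
  next
    fix x y assume "x \<in> C" "y \<in> C"
    then obtain v w where vw: "v \<in> ?V" "w \<in> ?V" "x = \<epsilon> \<otimes> v" "y = \<epsilon> \<otimes> w" unfolding C_def by blast
    have "x \<oplus> y = \<epsilon> \<otimes> (v \<oplus> w)" unfolding vw using e colonD(2)[OF vw(1)] colonD(2)[OF vw(2)] by algebra
    thus "x \<oplus> y \<in> C" unfolding C_def using ideal_a_closed[OF VI vw(1,2)] by blast
  next
    fix x y assume "x \<in> C" and y: "y \<in> carrier R"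
    then obtain v where v: "v \<in> ?V" "x = \<epsilon> \<otimes> v" unfolding C_def by blast
    have "y \<otimes> x = \<epsilon> \<otimes> (y \<otimes> v)" unfolding v(2) using e colonD(2)[OF v(1)] y by algebra
    thus "y \<otimes> x \<in> C" unfolding C_def using ideal.I_l_closed[OF VI v(1) y] by blast
  qed
  have epsJV: "\<epsilon> \<otimes> w \<in> ideal_prod R J C" if w: "w \<in> ideal_prod R J ?V" for w
  proof -
    have "ideal_prod R J ?V \<subseteq> colon_ideal R (ideal_prod R J C) \<epsilon>"
    proof (rule ideal_prod_subsetI[OF ideal_colon_ideal[OF ideal_prod_is_ideal[OF ideal_J C] e]])
      fix j v assume j: "j \<in> J" and v: "v \<in> ?V"
      have c: "j \<in> carrier R" "v \<in> carrier R" using ideal_carr[OF ideal_J j] colonD(2)[OF v] .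
      have "j \<otimes> (\<epsilon> \<otimes> v) \<in> ideal_prod R J C" using j v unfolding C_def by (intro ideal_prod.prod imageI)
      moreover have "(j \<otimes> v) \<otimes> \<epsilon> = j \<otimes> (\<epsilon> \<otimes> v)" using c e by algebra
      ultimately show "j \<otimes> v \<in> colon_ideal R (ideal_prod R J C) \<epsilon>" using c by (intro colonI) simp_all
    qed
    hence wC: "w \<in> colon_ideal R (ideal_prod R J C) \<epsilon>" using w by blast
    show ?thesis using colonD[OF wC] m_comm[of w \<epsilon>] e by simp
  qed
  \<comment> \<open>With w in \<open>J V\<close> one has w g = w (g + \<epsilon>) - \<epsilon> w,
    and the last term is in \<open>J C\<close> because \<open>C\<close> is \<epsilon>
    \<open>V\<close>.\<close>
  have "C \<subseteq> ?I'"
  proof (rule nakayama[OF II' C])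
    fix x assume "x \<in> C"
    then obtain v where v: "v \<in> ?V" "x = \<epsilon> \<otimes> v" unfolding C_def by blast
    have vc: "v \<in> carrier R" by (rule colonD(2)[OF v(1)])
    obtain w where w: "w \<in> ideal_prod R J ?V" "x \<ominus> w \<otimes> g \<in> H" using V2[OF v(1)] unfolding v(2) by (rule linE)
    have wc: "w \<in> carrier R" by (rule ideal_carr[OF JV w(1)])
    have xc: "x \<in> carrier R" unfolding v(2) using e vc by simp
    have "(x \<oplus> \<epsilon> \<otimes> w) \<ominus> w \<otimes> (g \<oplus> \<epsilon>) = x \<ominus> w \<otimes> g" using xc e wc g by algebra
    hence "x \<oplus> \<epsilon> \<otimes> w \<in> ?I'" using w(2) xc e wc by (intro linI[of _ w]) simp_all
    moreover have "\<ominus> (\<epsilon> \<otimes> w) \<in> ideal_prod R J C"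
      by (rule ideal_a_inv_closed[OF ideal_prod_is_ideal[OF ideal_J C] epsJV[OF w(1)]])
    moreover have "x = (x \<oplus> \<epsilon> \<otimes> w) \<oplus> (\<ominus> (\<epsilon> \<otimes> w))" using xc e wc by algebra
    ultimately show "\<exists>b\<in>?I'. \<exists>d\<in>ideal_prod R J C. x = b \<oplus> d" by blast
  qed
  hence epsV: "\<epsilon> \<otimes> v \<in> ?I'" if "v \<in> ?V" for v using that unfolding C_def by blast

  have S3: "u \<otimes> q \<in> ?I'" if u: "u \<in> P c" and q: "q \<in> colon_ideal R H h" for u q
  proof -
    obtain v where v: "v \<in> ?V" "u \<otimes> q \<ominus> v \<otimes> g \<in> H" using lift[OF u q] by blast
    have c: "u \<in> carrier R" "q \<in> carrier R" "v \<in> carrier R"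
      using P_carr[OF u] colonD(2)[OF q] colonD(2)[OF v(1)] .
    have "(u \<otimes> q \<oplus> \<epsilon> \<otimes> v) \<ominus> v \<otimes> (g \<oplus> \<epsilon>) = u \<otimes> q \<ominus> v \<otimes> g" using c e g by algebra
    hence "u \<otimes> q \<oplus> \<epsilon> \<otimes> v \<in> ?I'" using v(2) c e by (intro linI[of _ v]) simp_all
    hence "(u \<otimes> q \<oplus> \<epsilon> \<otimes> v) \<ominus> \<epsilon> \<otimes> v \<in> ?I'" using epsV[OF v(1)] by (rule ideal_a_minus_closed[OF II'])
    moreover have "(u \<otimes> q \<oplus> \<epsilon> \<otimes> v) \<ominus> \<epsilon> \<otimes> v = u \<otimes> q" using c e by algebra
    ultimately show ?thesis by simp
  qed

  \<comment> \<open>Supplies the hypothesis for comparing the colon ideals of \<open>g\<close> and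
    \<open>g \<oplus> \<epsilon>\<close> over \<open>H + (h)\<close>, where \<open>h\<close> has
    been moved in front of \<open>g\<close>.\<close>
  have kK: "kills N (colon_ideal R ?K g) ?K"
    using kills_mono[OF kills_colon_step[OF H g h kA kc]] N by simp

  show ?thesis unfolding kills_def
  proof (intro ballI)
    fix u x assume u: "u \<in> P c" and "x \<in> colon_ideal R ?I' h"
    hence x: "x \<in> carrier R" "x \<otimes> h \<in> ?I'" using colonD by blast+
    have uc: "u \<in> carrier R" by (rule P_carr[OF u])
    obtain y where y: "y \<in> carrier R" "x \<otimes> h \<ominus> y \<otimes> (g \<oplus> \<epsilon>) \<in> H" using x(2) by (rule linE)
    have "y \<otimes> (g \<oplus> \<epsilon>) \<ominus> x \<otimes> h = \<ominus> (x \<otimes> h \<ominus> y \<otimes> (g \<oplus> \<epsilon>))" using x(1) y(1) g e h by algebra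
    also have "\<dots> \<in> H" by (rule ideal_a_inv_closed[OF H y(2)])
    finally have "y \<otimes> (g \<oplus> \<epsilon>) \<in> ?K" using x(1) y(1) g' by (intro linI[of _ x]) simp_all
    hence "y \<in> colon_ideal R ?K (g \<oplus> \<epsilon>)" by (rule colonI[OF y(1)])
    hence "y \<in> colon_ideal R ?K g" unfolding colon_perturb_eq[OF KI g eps ar kK] .
    from colonD(1)[OF this] obtain x1 where x1: "x1 \<in> carrier R" "y \<otimes> g \<ominus> x1 \<otimes> h \<in> H" by (rule linE)
    have "x1 \<otimes> h \<ominus> y \<otimes> g = \<ominus> (y \<otimes> g \<ominus> x1 \<otimes> h)" using x1(1) y(1) g h by algebra
    also have "\<dots> \<in> H" by (rule ideal_a_inv_closed[OF H x1(2)])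
    finally have "x1 \<otimes> h \<in> ?I" using x1(1) y(1) h by (intro linI[of _ y]) simp_all
    hence x1c: "x1 \<in> colon_ideal R ?I h" by (rule colonI[OF x1(1)])
    \<comment> \<open>The correction z is additive in d, but the coefficient v belonging to u x1
      must be the same for all summands of \<epsilon>. Therefore the condition is demanded for every
      v; two choices differ by an element of \<open>H : g\<close>, and the factor of order A in each
      product absorbs this.\<close>
    have S2: "\<exists>z\<in>carrier R. y \<otimes> d \<ominus> z \<otimes> h \<in> H \<and>
        (\<forall>u\<in>P c. \<forall>v\<in>carrier R. u \<otimes> x1 \<ominus> v \<otimes> g \<in> H \<longrightarrow> u \<otimes> z \<ominus> d \<otimes> v \<in> H)"
      if "d \<in> ideal_prod R (P c) (P (N - c))" for d
      using that
    proof induct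
      case (prod u0 t)
      \<comment> \<open>\<open>N - c\<close> exceeds \<open>A\<close>; for a product d = u0 t the
        witness is z = t v0, where u0 x1 = v0 g modulo \<open>H\<close>.\<close>
      have t: "t \<in> P A" using N by (intro P_antimonoD[OF _ prod(2)]) simp
      have c: "u0 \<in> carrier R" "t \<in> carrier R" using P_carr[OF prod(1)] P_carr[OF t] .
      obtain v0 where v0: "v0 \<in> carrier R" "u0 \<otimes> x1 \<ominus> v0 \<otimes> g \<in> H"
        using killsD[OF kc prod(1) x1c] by (rule linE)
      have "(u0 \<otimes> y \<ominus> v0 \<otimes> h) \<otimes> g = u0 \<otimes> (y \<otimes> g \<ominus> x1 \<otimes> h) \<oplus> h \<otimes> (u0 \<otimes> x1 \<ominus> v0 \<otimes> g)"
        using c v0(1) y(1) x1(1) g h by algebra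
      also have "\<dots> \<in> H"
        by (rule ideal_a_closed[OF H ideal.I_l_closed[OF H x1(2) c(1)] ideal.I_l_closed[OF H v0(2) h]])
      finally have "u0 \<otimes> y \<ominus> v0 \<otimes> h \<in> colon_ideal R H g" using c v0(1) y(1) h by (intro colonI) simp_all
      hence "t \<otimes> (u0 \<otimes> y \<ominus> v0 \<otimes> h) \<in> H" by (rule killsD[OF kA t])
      moreover have "t \<otimes> (u0 \<otimes> y \<ominus> v0 \<otimes> h) = y \<otimes> (u0 \<otimes> t) \<ominus> (t \<otimes> v0) \<otimes> h"
        using c v0(1) y(1) h by algebra
      moreover have "u1 \<otimes> (t \<otimes> v0) \<ominus> (u0 \<otimes> t) \<otimes> v \<in> H"
        if u1: "u1 \<in> P c" and v: "v \<in> carrier R" "u1 \<otimes> x1 \<ominus> v \<otimes> g \<in> H" for u1 v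
      proof -
        have u1c: "u1 \<in> carrier R" by (rule P_carr[OF u1])
        have "(u1 \<otimes> v0 \<ominus> u0 \<otimes> v) \<otimes> g = u0 \<otimes> (u1 \<otimes> x1 \<ominus> v \<otimes> g) \<ominus> u1 \<otimes> (u0 \<otimes> x1 \<ominus> v0 \<otimes> g)"
          using c v0(1) u1c v(1) x1(1) g by algebra
        also have "\<dots> \<in> H"
          by (rule ideal_a_minus_closed[OF H ideal.I_l_closed[OF H v(2) c(1)] ideal.I_l_closed[OF H v0(2) u1c]])
        finally have "u1 \<otimes> v0 \<ominus> u0 \<otimes> v \<in> colon_ideal R H g" using c v0(1) u1c v(1) by (intro colonI) simp_all
        hence "t \<otimes> (u1 \<otimes> v0 \<ominus> u0 \<otimes> v) \<in> H" by (rule killsD[OF kA t])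
        moreover have "t \<otimes> (u1 \<otimes> v0 \<ominus> u0 \<otimes> v) = u1 \<otimes> (t \<otimes> v0) \<ominus> (u0 \<otimes> t) \<otimes> v"
          using c v0(1) u1c v(1) by algebra
        ultimately show ?thesis by simp
      qed
      ultimately show ?case using c v0(1) by (intro bexI[of _ "t \<otimes> v0"]) simp_all
    next
      case (sum d1 d2)
      have PP: "ideal (ideal_prod R (P c) (P (N - c))) R" by (rule ideal_prod_is_ideal[OF ideal_P ideal_P])
      have dc: "d1 \<in> carrier R" "d2 \<in> carrier R" using ideal_carr[OF PP sum(1)] ideal_carr[OF PP sum(3)] .
      obtain z1 where z1: "z1 \<in> carrier R" "y \<otimes> d1 \<ominus> z1 \<otimes> h \<in> H"
        "\<forall>u\<in>P c. \<forall>v\<in>carrier R. u \<otimes> x1 \<ominus> v \<otimes> g \<in> H \<longrightarrow> u \<otimes> z1 \<ominus> d1 \<otimes> v \<in> H" using sum(2) by blast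
      obtain z2 where z2: "z2 \<in> carrier R" "y \<otimes> d2 \<ominus> z2 \<otimes> h \<in> H"
        "\<forall>u\<in>P c. \<forall>v\<in>carrier R. u \<otimes> x1 \<ominus> v \<otimes> g \<in> H \<longrightarrow> u \<otimes> z2 \<ominus> d2 \<otimes> v \<in> H" using sum(4) by blast
      have "y \<otimes> (d1 \<oplus> d2) \<ominus> (z1 \<oplus> z2) \<otimes> h = (y \<otimes> d1 \<ominus> z1 \<otimes> h) \<oplus> (y \<otimes> d2 \<ominus> z2 \<otimes> h)"
        using dc z1(1) z2(1) y(1) h by algebra
      also have "\<dots> \<in> H" by (rule ideal_a_closed[OF H z1(2) z2(2)])
      finally have "y \<otimes> (d1 \<oplus> d2) \<ominus> (z1 \<oplus> z2) \<otimes> h \<in> H" .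
      moreover have "u \<otimes> (z1 \<oplus> z2) \<ominus> (d1 \<oplus> d2) \<otimes> v \<in> H"
        if u: "u \<in> P c" and v: "v \<in> carrier R" "u \<otimes> x1 \<ominus> v \<otimes> g \<in> H" for u v
      proof -
        have "u \<otimes> (z1 \<oplus> z2) \<ominus> (d1 \<oplus> d2) \<otimes> v = (u \<otimes> z1 \<ominus> d1 \<otimes> v) \<oplus> (u \<otimes> z2 \<ominus> d2 \<otimes> v)"
          using dc z1(1) z2(1) v(1) P_carr[OF u] by algebra
        moreover have "u \<otimes> z1 \<ominus> d1 \<otimes> v \<in> H" "u \<otimes> z2 \<ominus> d2 \<otimes> v \<in> H" using z1(3) z2(3) u v by blast+
        ultimately show ?thesis using ideal_a_closed[OF H] by simp
      qed
      ultimately show ?case using z1(1) z2(1) by (intro bexI[of _ "z1 \<oplus> z2"]) simp_all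
    qed
    have "\<epsilon> \<in> ideal_prod R (P c) (P (N - c))" using eps P_add[of c "N - c"] N by simp
    from S2[OF this] obtain z where z: "z \<in> carrier R" "y \<otimes> \<epsilon> \<ominus> z \<otimes> h \<in> H"
      "\<forall>u\<in>P c. \<forall>v\<in>carrier R. u \<otimes> x1 \<ominus> v \<otimes> g \<in> H \<longrightarrow> u \<otimes> z \<ominus> \<epsilon> \<otimes> v \<in> H" by blast
    have "(x \<ominus> x1 \<ominus> z) \<otimes> h =
        (x \<otimes> h \<ominus> y \<otimes> (g \<oplus> \<epsilon>)) \<oplus> ((y \<otimes> g \<ominus> x1 \<otimes> h) \<oplus> (y \<otimes> \<epsilon> \<ominus> z \<otimes> h))"
      using x(1) x1(1) z(1) y(1) g h e by algebra
    also have "\<dots> \<in> H" by (rule ideal_a_closed[OF H y(2) ideal_a_closed[OF H x1(2) z(2)]])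
    finally have "x \<ominus> x1 \<ominus> z \<in> colon_ideal R H h" using x(1) x1(1) z(1) by (intro colonI) simp_all
    hence q: "u \<otimes> (x \<ominus> x1 \<ominus> z) \<in> ?I'" by (rule S3[OF u])
    obtain v where v: "v \<in> carrier R" "u \<otimes> x1 \<ominus> v \<otimes> g \<in> H" using killsD[OF kc u x1c] by (rule linE)
    have "u \<otimes> (x1 \<oplus> z) \<ominus> v \<otimes> (g \<oplus> \<epsilon>) = (u \<otimes> x1 \<ominus> v \<otimes> g) \<oplus> (u \<otimes> z \<ominus> \<epsilon> \<otimes> v)"
      using uc x1(1) z(1) v(1) g e by algebra
    also have "\<dots> \<in> H" using z(3) u v by (intro ideal_a_closed[OF H]) blast+
    finally have "u \<otimes> (x1 \<oplus> z) \<in> ?I'" using uc x1(1) z(1) v(1) by (intro linI[of _ v]) simp_all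
    from ideal_a_closed[OF II' q this]
    have "u \<otimes> (x \<ominus> x1 \<ominus> z) \<oplus> u \<otimes> (x1 \<oplus> z) \<in> ?I'" .
    moreover have "u \<otimes> (x \<ominus> x1 \<ominus> z) \<oplus> u \<otimes> (x1 \<oplus> z) = u \<otimes> x" using uc x(1) x1(1) z(1) by algebra
    ultimately show "u \<otimes> x \<in> ?I'" by simp
  qed
qed

end

section \<open>Initial ideals and Artin--Rees numbers\<close>

context adic_ring
begin

lemma in_sub_refl: "ideal I R \<Longrightarrow> in_sub I I"
  unfolding in_sub_def
proof (intro allI ballI)
  fix n x assume I: "ideal I R" and x: "x \<in> I \<inter> P n"
  have "x \<ominus> x = \<zero>" using x P_carr[of x n] by (simp add: a_minus_def r_neg)
  thus "\<exists>x'\<in>I. x \<ominus> x' \<in> P (Suc n)" using x ideal_zero_closed[OF ideal_P] by (metis IntD1)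
qed

text \<open>An approximation in degree n has itself order n. This is conditional on
  \<open>x'\<close> being in the carrier, since \<open>I'\<close> is an arbitrary set here.\<close>

lemma in_subE:
  assumes "in_sub I I'" "x \<in> I" "x \<in> P n"
  obtains x' where "x' \<in> I'" "x' \<in> carrier R \<Longrightarrow> x' \<in> P n" "x \<ominus> x' \<in> P (Suc n)"
proof -
  obtain x' where x': "x' \<in> I'" "x \<ominus> x' \<in> P (Suc n)"
    using assms unfolding in_sub_def by blast
  have "x' \<in> P n" if c: "x' \<in> carrier R"
  proof -
    have "x \<ominus> x' \<in> P n" by (rule P_antimonoD[OF _ x'(2)]) simp
    hence "x \<ominus> (x \<ominus> x') \<in> P n" by (rule ideal_a_minus_closed[OF ideal_P assms(3)])
    moreover have "x \<ominus> (x \<ominus> x') = x'" using c P_carr[OF assms(3)] by algebra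
    ultimately show ?thesis by simp
  qed
  thus ?thesis using that x' by blast
qed

lemma in_sub_trans:
  assumes I: "ideal I R" "ideal I' R" "ideal I'' R" and "in_sub I I'" "in_sub I' I''"
  shows "in_sub I I''"
  unfolding in_sub_def
proof (intro allI ballI)
  fix n x assume x: "x \<in> I \<inter> P n"
  then obtain y where y: "y \<in> I'" "y \<in> carrier R \<Longrightarrow> y \<in> P n" "x \<ominus> y \<in> P (Suc n)"
    using in_subE[OF assms(4), of x n] by blast
  have yc: "y \<in> carrier R" by (rule ideal_carr[OF I(2) y(1)])
  have xc: "x \<in> carrier R" by (rule ideal_carr[OF I(1)]) (use x in blast)
  obtain z where z: "z \<in> I''" "y \<ominus> z \<in> P (Suc n)"
    using in_subE[OF assms(5) y(1) y(2)[OF yc]] by blast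
  have "x \<ominus> z = (x \<ominus> y) \<oplus> (y \<ominus> z)"
    using xc yc ideal_carr[OF I(3) z(1)] by algebra
  also have "\<dots> \<in> P (Suc n)" by (rule ideal_a_closed[OF ideal_P y(3) z(2)])
  finally show "\<exists>x'\<in>I''. x \<ominus> x' \<in> P (Suc n)" using z(1) by blast
qed

text \<open>The factors from \<open>I\<close> are replaced with an error of order n + 1, and the
  factors from \<open>J\<close> raise the error of the products to n + 2, one more than the order of
  the products.\<close>

lemma in_sub_ideal_prod:
  assumes I: "ideal I R" "ideal I' R" and sub: "in_sub I I'" and y: "y \<in> ideal_prod R J (P n \<inter> I)"
  shows "\<exists>d\<in>ideal_prod R J (P n \<inter> I'). y \<ominus> d \<in> P (Suc (Suc n))"
  using y
proof induct
  case (prod j a)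
  obtain a' where a': "a' \<in> I'" "a' \<in> carrier R \<Longrightarrow> a' \<in> P n" "a \<ominus> a' \<in> P (Suc n)"
    using in_subE[OF sub, of a n] prod(2) by blast
  have c: "a' \<in> carrier R" "a \<in> carrier R" "j \<in> carrier R"
    using ideal_carr[OF I(2) a'(1)] ideal_carr[OF I(1), of a] prod(2) ideal_carr[OF ideal_J prod(1)] by auto
  have "j \<in> P (Suc 0)" using prod(1) unfolding P_1 .
  hence "j \<otimes> (a \<ominus> a') \<in> P (Suc 0 + Suc n)" by (rule P_mult[OF _ a'(3)])
  moreover have "j \<otimes> a \<ominus> j \<otimes> a' = j \<otimes> (a \<ominus> a')" using c by algebra
  moreover have "j \<otimes> a' \<in> ideal_prod R J (P n \<inter> I')"
    using a'(1) a'(2)[OF c(1)] by (intro ideal_prod.prod[OF prod(1)]) simp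
  ultimately show ?case by (intro bexI[of _ "j \<otimes> a'"]) simp_all
next
  case (sum y1 y2)
  then obtain d1 d2 where d: "d1 \<in> ideal_prod R J (P n \<inter> I')" "y1 \<ominus> d1 \<in> P (Suc (Suc n))"
    "d2 \<in> ideal_prod R J (P n \<inter> I')" "y2 \<ominus> d2 \<in> P (Suc (Suc n))" by blast
  note c = ideal_carr[OF ideal_prod_P_inter(1)[OF I(1)] sum(1)] ideal_carr[OF ideal_prod_P_inter(1)[OF I(1)] sum(3)]
    ideal_carr[OF ideal_prod_P_inter(1)[OF I(2)] d(1)] ideal_carr[OF ideal_prod_P_inter(1)[OF I(2)] d(3)]
  have "(y1 \<oplus> y2) \<ominus> (d1 \<oplus> d2) = (y1 \<ominus> d1) \<oplus> (y2 \<ominus> d2)" using c by algebra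
  also have "\<dots> \<in> P (Suc (Suc n))" by (rule ideal_a_closed[OF ideal_P d(2,4)])
  finally show ?case using ideal_prod.sum[OF d(1,3)] by blast
qed

end

context noetherian_adic_ring
begin

lemma artin_rees_spec:
  assumes "ideal I R"
  shows "\<forall>n\<ge>artin_rees R J I. P (Suc n) \<inter> I = ideal_prod R J (P n \<inter> I)"
  unfolding artin_rees_def by (rule LeastI_ex[OF artin_rees_exists[OF assms]])

lemma artin_rees_ar_bound: "ideal I R \<Longrightarrow> artin_rees R J I < N \<Longrightarrow> ar_bound I N"
  by (rule artin_rees_imp_ar_bound[OF _ artin_rees_spec])

end

context local_adic_ring
begin

text \<open>Passing to \<open>I\<close>, using its Artin--Rees equality there and passing back
  approximates an element of \<open>I'\<close> by the product ideal, one order better in each round.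
  The exponents grow from n on, and Krull's intersection theorem removes the remaining
  error.\<close>

lemma in_sub_artin_rees:
  assumes I: "ideal I R" "ideal I' R" and sub: "in_sub I I'" "in_sub I' I"
    and ar: "\<forall>n\<ge>c. P (Suc n) \<inter> I = ideal_prod R J (P n \<inter> I)" and n: "n \<ge> c"
  shows "P (Suc n) \<inter> I' = ideal_prod R J (P n \<inter> I')"
proof
  show "ideal_prod R J (P n \<inter> I') \<subseteq> P (Suc n) \<inter> I'" by (rule ideal_prod_P_inter(2)[OF I(2)])
  have step: "\<exists>d\<in>ideal_prod R J (P m \<inter> I'). x \<ominus> d \<in> P (Suc (Suc m)) \<inter> I'"
    if m: "m \<ge> c" and x: "x \<in> P (Suc m) \<inter> I'" for m x
  proof -
    obtain y where y: "y \<in> I" "y \<in> carrier R \<Longrightarrow> y \<in> P (Suc m)" "x \<ominus> y \<in> P (Suc (Suc m))"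
      using in_subE[OF sub(2), of x "Suc m"] x by blast
    have yc: "y \<in> carrier R" by (rule ideal_carr[OF I(1) y(1)])
    have "y \<in> ideal_prod R J (P m \<inter> I)" using ar m y(1) y(2)[OF yc] by blast
    from in_sub_ideal_prod[OF I sub(1) this]
    obtain d where d: "d \<in> ideal_prod R J (P m \<inter> I')" "y \<ominus> d \<in> P (Suc (Suc m))" by blast
    have dI: "d \<in> I'" using d(1) ideal_prod_P_inter(2)[OF I(2)] by blast
    have xI: "x \<in> I'" using x by simp
    have "x \<ominus> d = (x \<ominus> y) \<oplus> (y \<ominus> d)"
      using ideal_carr[OF I(2) xI] yc ideal_carr[OF I(2) dI] by algebra
    also have "\<dots> \<in> P (Suc (Suc m))" by (rule ideal_a_closed[OF ideal_P y(3) d(2)])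
    finally show ?thesis using d(1) ideal_a_minus_closed[OF I(2) xI dI] by blast
  qed
  show "P (Suc n) \<inter> I' \<subseteq> ideal_prod R J (P n \<inter> I')"
  proof
    fix x assume x: "x \<in> P (Suc n) \<inter> I'"
    have xc: "x \<in> carrier R" using x ideal_carr[OF I(2)] by blast
    note PI = ideal_prod_P_inter[OF I(2), of n]
    have app: "\<exists>d\<in>ideal_prod R J (P n \<inter> I'). x \<ominus> d \<in> P (Suc (n + k)) \<inter> I'" for k
    proof (induct k)
      case 0
      have "x \<ominus> \<zero> = x" using xc by (simp add: a_minus_def)
      thus ?case using x ideal_zero_closed[OF PI(1)] by (intro bexI[of _ \<zero>]) simp_all
    next
      case (Suc k)
      then obtain d where d: "d \<in> ideal_prod R J (P n \<inter> I')" "x \<ominus> d \<in> P (Suc (n + k)) \<inter> I'" by blast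
      have "c \<le> n + k" using n by simp
      from step[OF this d(2)] obtain d' where
        d': "d' \<in> ideal_prod R J (P (n + k) \<inter> I')" "(x \<ominus> d) \<ominus> d' \<in> P (Suc (Suc (n + k))) \<inter> I'" by blast
      have "ideal_prod R J (P (n + k) \<inter> I') \<subseteq> ideal_prod R J (P n \<inter> I')"
        using P_antimono[of n "n + k"] by (intro ideal_prod_mono) auto
      hence dd: "d \<oplus> d' \<in> ideal_prod R J (P n \<inter> I')" using d'(1) by (intro ideal_prod.sum[OF d(1)]) blast
      have "x \<ominus> (d \<oplus> d') = (x \<ominus> d) \<ominus> d'"
        using xc ideal_carr[OF PI(1) d(1)] ideal_carr[OF ideal_prod_P_inter(1)[OF I(2)] d'(1)] by algebra
      hence "x \<ominus> (d \<oplus> d') \<in> P (Suc (n + Suc k)) \<inter> I'" using d'(2) unfolding add_Suc_right by metis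
      thus ?case using dd by blast
    qed
    show "x \<in> ideal_prod R J (P n \<inter> I')"
    proof (rule krull_intersection[OF PI(1)])
      fix k
      obtain d where d: "d \<in> ideal_prod R J (P n \<inter> I')" "x \<ominus> d \<in> P (Suc (n + k)) \<inter> I'" using app by blast
      have "x \<ominus> d \<in> P k" by (rule P_antimonoD[of _ "Suc (n + k)"]) (simp, use d(2) in blast)
      moreover have "x = d \<oplus> (x \<ominus> d)" using xc ideal_carr[OF PI(1) d(1)] by algebra
      ultimately show "\<exists>b\<in>ideal_prod R J (P n \<inter> I'). \<exists>d\<in>P k. x = b \<oplus> d" using d(1) by blast
    qed
  qed
qed

lemma in_sub_artin_rees_eq:
  assumes "ideal I R" "ideal I' R" "in_sub I I'" "in_sub I' I"
  shows "artin_rees R J I' = artin_rees R J I"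
proof -
  have "(\<forall>n\<ge>c. P (Suc n) \<inter> I' = ideal_prod R J (P n \<inter> I')) \<longleftrightarrow>
        (\<forall>n\<ge>c. P (Suc n) \<inter> I = ideal_prod R J (P n \<inter> I))" for c
    using in_sub_artin_rees[OF assms] in_sub_artin_rees[OF assms(2,1,4,3)] by meson
  thus ?thesis unfolding artin_rees_def by (simp only:)
qed

end

section \<open>Perturbing a sequence\<close>

context adic_ring
begin

text \<open>Expresses that the Loewy length of \<open>colon_quot R f i\<close> is at most
  \<open>n\<close>. The \<open>a i\<close> in the perturbation lemmas are thus arbitrary upper
  bounds.\<close>

definition colon_kills :: "(nat \<Rightarrow> 'a) \<Rightarrow> nat \<Rightarrow> nat \<Rightarrow> bool" where
  "colon_kills f i n \<longleftrightarrow>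
     kills n (colon_ideal R (seq_ideal R f (i - 1)) (f i)) (seq_ideal R f (i - 1))"

lemma ideal_seq_ideal: "(\<And>k. k \<in> {1..i} \<Longrightarrow> f k \<in> carrier R) \<Longrightarrow> ideal (seq_ideal R f i) R"
  by (rule genideal_ideal) blast

lemma seq_ideal_cong: "(\<And>k. k \<in> {1..i} \<Longrightarrow> f k = f' k) \<Longrightarrow> seq_ideal R f i = seq_ideal R f' i"
  by (rule arg_cong[where f = "genideal R"]) (rule image_cong[OF refl])

lemma colon_kills_cong:
  assumes "i \<in> {1..r}" "\<And>k. k \<in> {1..r} \<Longrightarrow> f k = f' k"
  shows "colon_kills f i n \<longleftrightarrow> colon_kills f' i n"
proof -
  have "seq_ideal R f (i - 1) = seq_ideal R f' (i - 1)" using assms(1) by (intro seq_ideal_cong assms(2)) auto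
  thus ?thesis unfolding colon_kills_def using assms by simp
qed

end

context local_adic_ring
begin

lemma perturb_one:
  fixes f :: "nat \<Rightarrow> 'a" and a :: "nat \<Rightarrow> nat"
  assumes f: "\<And>i. i \<in> {1..r} \<Longrightarrow> f i \<in> carrier R"
    and k: "\<And>i. i \<in> {1..r} \<Longrightarrow> colon_kills f i (a i)"
    and ar: "\<And>i. i \<in> {1..r} \<Longrightarrow> artin_rees R J (seq_ideal R f i) < N"
    and N: "(\<Sum>i=1..r. a i) < N" and eps: "\<epsilon> \<in> P N" and j: "j \<in> {1..r}" and i: "i \<in> {1..r}"
  defines "f' \<equiv> f(j := f j \<oplus> \<epsilon>)"
  shows "colon_kills f' i (a i) \<and> in_sub (seq_ideal R f i) (seq_ideal R f' i) \<and>
         in_sub (seq_ideal R f' i) (seq_ideal R f i)"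
proof -
  \<comment> \<open>For i at least j, the ideals of \<open>f\<close> and of \<open>f'\<close> both
    arise from the same \<open>D i\<close> by adjoining one element. The index j is removed, not the
    value, so an equal element at another place is kept.\<close>
  define D where "D i = Idl (f ` ({1..i} - {j}))" for i
  have fc: "f ` ({1..i} - {j}) \<subseteq> carrier R" if "i \<le> r" for i using f that by auto
  have DI: "ideal (D i) R" if "i \<le> r" for i unfolding D_def by (rule genideal_ideal[OF fc[OF that]])
  have ec: "\<epsilon> \<in> carrier R" by (rule P_carr[OF eps])
  have fj: "f j \<in> carrier R" by (rule f[OF j])
  have seq: "seq_ideal R f i = lin (D i) (carrier R) (f j)" if "j \<le> i" "i \<le> r" for i
  proof -
    have "f ` {1..i} = insert (f j) (f ` ({1..i} - {j}))" using that j by auto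
    thus ?thesis unfolding D_def using genideal_insert_lin[OF fc[OF that(2)] fj] by simp
  qed
  have seq': "seq_ideal R f' i = lin (D i) (carrier R) (f j \<oplus> \<epsilon>)" if "j \<le> i" "i \<le> r" for i
  proof -
    have "f' ` {1..i} = insert (f j \<oplus> \<epsilon>) (f ` ({1..i} - {j}))" using that j by (auto simp: f'_def)
    thus ?thesis unfolding D_def using genideal_insert_lin[OF fc[OF that(2)] a_closed[OF fj ec]] by simp
  qed
  have low: "seq_ideal R f' i = seq_ideal R f i" if "i < j" for i
    using that by (intro seq_ideal_cong) (auto simp: f'_def)
  have Dj: "D j = seq_ideal R f (j - 1)"
  proof -
    have "{1..j} - {j} = {1..j - 1}" by auto
    thus ?thesis by (simp add: D_def)
  qed
  have DSuc: "D (Suc i) = lin (D i) (carrier R) (f (Suc i))" if "j \<le> i" "Suc i \<le> r" for i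
  proof -
    have "{1..Suc i} - {j} = insert (Suc i) ({1..i} - {j})" using that by auto
    hence "f ` ({1..Suc i} - {j}) = insert (f (Suc i)) (f ` ({1..i} - {j}))" by simp
    moreover have "f (Suc i) \<in> carrier R" using that by (intro f) simp
    ultimately show ?thesis unfolding D_def using genideal_insert_lin[OF fc[of i]] that by simp
  qed
  \<comment> \<open>The start is the hypothesis for j, since \<open>D j\<close> is generated by the
    elements before j. Each further element is exchanged with \<open>f j\<close> at the cost of its
    own exponent.\<close>
  have kD: "i \<le> r \<Longrightarrow> kills (\<Sum>k=j..i. a k) (colon_ideal R (D i) (f j)) (D i)" if "j \<le> i" for i
    using that
  proof (induct i rule: dec_induct)
    case base
    show ?case using k[OF j] unfolding colon_kills_def Dj by simp
  next
    case (step i)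
    have ir: "i \<le> r" using step by simp
    have fS: "f (Suc i) \<in> carrier R" using step.prems by (intro f) simp
    have "kills (a (Suc i)) (colon_ideal R (lin (D i) (carrier R) (f j)) (f (Suc i))) (lin (D i) (carrier R) (f j))"
      using k[of "Suc i"] step.prems unfolding colon_kills_def seq[OF step.hyps(1) ir, symmetric] by simp
    from kills_colon_step[OF DI[OF ir] fj fS step.hyps(3)[OF ir] this]
    show ?case unfolding DSuc[OF step.hyps(1) step.prems] using step.hyps(1) by simp
  qed
  have sum_le: "(\<Sum>k=j..i. a k) < N" if "i \<le> r" for i
  proof -
    have "(\<Sum>k=j..i. a k) \<le> (\<Sum>k=1..r. a k)" using that j by (intro sum_mono2) auto
    thus ?thesis using N by simp
  qed
  have arb: "ar_bound (seq_ideal R f i) N" if "i \<in> {1..r}" for i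
    using that by (intro artin_rees_ar_bound ideal_seq_ideal f ar) auto
  show ?thesis
  proof (cases "i < j")
    case True
    have "f' i = f i" using True by (simp add: f'_def)
    moreover have "seq_ideal R f' (i - 1) = seq_ideal R f (i - 1)" using True by (intro low) simp
    ultimately have "colon_kills f' i (a i)" using k[OF i] unfolding colon_kills_def by simp
    moreover have "in_sub (seq_ideal R f i) (seq_ideal R f i)" 
      using i by (intro in_sub_refl ideal_seq_ideal f) auto
    ultimately show ?thesis unfolding low[OF True] by simp
  next
    case False
    hence ji: "j \<le> i" and ir: "i \<le> r" using i by auto
    have arD: "ar_bound (lin (D i) (carrier R) (f j)) N" using arb[OF i] unfolding seq[OF ji ir] .
    have kN: "kills N (colon_ideal R (D i) (f j)) (D i)"
      by (rule kills_mono[OF kD[OF ji ir]]) (use sum_le[OF ir] in simp)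
    note pert = DI[OF ir] fj eps arD kN
    have "in_sub (seq_ideal R f i) (seq_ideal R f' i)" "in_sub (seq_ideal R f' i) (seq_ideal R f i)"
      unfolding seq[OF ji ir] seq'[OF ji ir]
      by (rule lin_perturb_in_sub[OF pert], rule lin_perturb_in_sub_rev[OF pert])
    moreover have "colon_kills f' i (a i)"
    proof (cases "i = j")
      case True
      have "f' j = f j \<oplus> \<epsilon>" by (simp add: f'_def)
      moreover have "seq_ideal R f' (j - 1) = seq_ideal R f (j - 1)" using j by (intro low) auto
      ultimately show ?thesis
        using k[OF j] colon_perturb_eq[OF pert] unfolding colon_kills_def True Dj by simp
    next
      case False
      \<comment> \<open>Here \<open>H\<close> is \<open>D i0\<close>, \<open>g\<close> is
        \<open>f j\<close> and \<open>h\<close> is \<open>f i\<close>; the exponents a j + ... + a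
        i0 and a i add up to a partial sum below \<open>N\<close>.\<close>
      then obtain i0 where i0: "i = Suc i0" "j \<le> i0" "i0 \<le> r" using ji ir by (cases i) auto
      have fi: "f i \<in> carrier R" by (rule f[OF i])
      have f'i: "f' i = f i" using False by (simp add: f'_def)
      have kc: "kills (a i) (colon_ideal R (lin (D i0) (carrier R) (f j)) (f i)) (lin (D i0) (carrier R) (f j))"
        using k[OF i] unfolding colon_kills_def seq[OF i0(2,3), symmetric] i0(1) by simp
      have "(\<Sum>k=j..i0. a k) + a i < N" using sum_le[OF ir] i0 by simp
      moreover have "ar_bound (lin (lin (D i0) (carrier R) (f i)) (carrier R) (f j)) N"
        using arD DSuc[OF i0(2)] ir unfolding i0(1) by simp
      ultimately have "kills (a i) (colon_ideal R (lin (D i0) (carrier R) (f j \<oplus> \<epsilon>)) (f i))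
          (lin (D i0) (carrier R) (f j \<oplus> \<epsilon>))"
        by (rule kills_perturb[OF DI[OF i0(3)] fj fi eps kD[OF i0(2,3)] kc])
      thus ?thesis unfolding colon_kills_def f'i seq'[OF i0(2,3), symmetric] by (simp add: i0(1))
    qed
    ultimately show ?thesis by blast
  qed
qed

text \<open>Interpolates by sequences \<open>F m\<close> with only the first m elements changed.
  Before each step the hypotheses must hold for \<open>F m\<close>: the exponents are preserved, and
  the Artin--Rees numbers are those of \<open>f\<close> because the initial ideals agree.\<close>

lemma perturb_all:
  fixes f f' \<epsilon> :: "nat \<Rightarrow> 'a" and a :: "nat \<Rightarrow> nat"
  assumes f: "\<And>i. i \<in> {1..r} \<Longrightarrow> f i \<in> carrier R"
    and k: "\<And>i. i \<in> {1..r} \<Longrightarrow> colon_kills f i (a i)"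
    and ar: "\<And>i. i \<in> {1..r} \<Longrightarrow> artin_rees R J (seq_ideal R f i) < N"
    and N: "(\<Sum>i=1..r. a i) < N" and eps: "\<And>i. i \<in> {1..r} \<Longrightarrow> \<epsilon> i \<in> P N"
    and f': "\<And>i. i \<in> {1..r} \<Longrightarrow> f' i = f i \<oplus> \<epsilon> i" and i: "i \<in> {1..r}"
  shows "colon_kills f' i (a i)" "in_sub (seq_ideal R f i) (seq_ideal R f' i)"
    "in_sub (seq_ideal R f' i) (seq_ideal R f i)"
proof -
  define F where "F m = (\<lambda>k. if k \<le> m then f k \<oplus> \<epsilon> k else f k)" for m :: nat
  have Fc: "F m i \<in> carrier R" if "i \<in> {1..r}" for m i
    using f[OF that] P_carr[OF eps[OF that]] by (simp add: F_def)
  have FI: "ideal (seq_ideal R (F m) i) R" if "i \<in> {1..r}" for m i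
    using that by (intro ideal_seq_ideal Fc) auto
  have fI: "ideal (seq_ideal R f i) R" if "i \<in> {1..r}" for i
    using that by (intro ideal_seq_ideal f) auto
  have main: "m \<le> r \<Longrightarrow> \<forall>i\<in>{1..r}. colon_kills (F m) i (a i) \<and>
      in_sub (seq_ideal R f i) (seq_ideal R (F m) i) \<and> in_sub (seq_ideal R (F m) i) (seq_ideal R f i)" for m
  proof (induct m)
    case 0
    show ?case
    proof
      fix i assume i: "i \<in> {1..r}"
      have eq: "F 0 k = f k" if "k \<in> {1..r}" for k using that by (simp add: F_def)
      have "seq_ideal R (F 0) i = seq_ideal R f i" using i by (intro seq_ideal_cong eq) auto
      thus "colon_kills (F 0) i (a i) \<and> in_sub (seq_ideal R f i) (seq_ideal R (F 0) i) \<and>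
          in_sub (seq_ideal R (F 0) i) (seq_ideal R f i)"
        using colon_kills_cong[OF i eq] k[OF i] in_sub_refl[OF fI[OF i]] by simp
    qed
  next
    case (Suc m)
    have ih: "colon_kills (F m) i (a i)" "in_sub (seq_ideal R f i) (seq_ideal R (F m) i)"
      "in_sub (seq_ideal R (F m) i) (seq_ideal R f i)" if "i \<in> {1..r}" for i
      using Suc that by simp_all
    have m: "Suc m \<in> {1..r}" using Suc.prems by simp
    have arm: "artin_rees R J (seq_ideal R (F m) i) < N" if i: "i \<in> {1..r}" for i
      using in_sub_artin_rees_eq[OF fI[OF i] FI[OF i] ih(2,3)[OF i]] ar[OF i] by simp
    have FS: "F (Suc m) = (F m)(Suc m := F m (Suc m) \<oplus> \<epsilon> (Suc m))"
      by (auto simp: F_def fun_eq_iff)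
    show ?case
    proof
      fix i assume i: "i \<in> {1..r}"
      have "colon_kills (F (Suc m)) i (a i) \<and>
          in_sub (seq_ideal R (F m) i) (seq_ideal R (F (Suc m)) i) \<and>
          in_sub (seq_ideal R (F (Suc m)) i) (seq_ideal R (F m) i)"
        unfolding FS by (rule perturb_one[OF Fc ih(1) arm N eps[OF m] m i])
      thus "colon_kills (F (Suc m)) i (a i) \<and> in_sub (seq_ideal R f i) (seq_ideal R (F (Suc m)) i) \<and>
          in_sub (seq_ideal R (F (Suc m)) i) (seq_ideal R f i)"
        using in_sub_trans[OF fI[OF i] FI[OF i] FI[OF i] ih(2)[OF i]]
          in_sub_trans[OF FI[OF i] FI[OF i] fI[OF i] _ ih(3)[OF i]] by blast
    qed
  qed
  have eq: "F r k = f' k" if "k \<in> {1..r}" for k using f'[OF that] that by (simp add: F_def)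
  have "seq_ideal R (F r) i = seq_ideal R f' i" using i by (intro seq_ideal_cong eq) auto
  thus "colon_kills f' i (a i)" "in_sub (seq_ideal R f i) (seq_ideal R f' i)"
    "in_sub (seq_ideal R f' i) (seq_ideal R f i)"
    using bspec[OF main[OF le_refl] i] colon_kills_cong[where f = "F r" and f' = f' and n = "a i", OF i eq]
    by simp_all
qed

text \<open>If \<open>n < a i\<close> worked for \<open>f'\<close>, then perturbing \<open>f'\<close> back to \<open>f\<close> with \<open>a i\<close> lowered to
  \<open>n\<close> would show that \<open>n\<close> works for \<open>f\<close>.\<close>

lemma perturb_colon_kills_iff:
  fixes f f' \<epsilon> :: "nat \<Rightarrow> 'a" and a :: "nat \<Rightarrow> nat"
  assumes f: "\<And>i. i \<in> {1..r} \<Longrightarrow> f i \<in> carrier R"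
    and k: "\<And>i n. i \<in> {1..r} \<Longrightarrow> colon_kills f i n \<longleftrightarrow> a i \<le> n"
    and ar: "\<And>i. i \<in> {1..r} \<Longrightarrow> artin_rees R J (seq_ideal R f i) < N"
    and N: "(\<Sum>i=1..r. a i) < N" and eps: "\<And>i. i \<in> {1..r} \<Longrightarrow> \<epsilon> i \<in> P N"
    and f': "\<And>i. i \<in> {1..r} \<Longrightarrow> f' i = f i \<oplus> \<epsilon> i" and i: "i \<in> {1..r}"
  shows "colon_kills f' i n \<longleftrightarrow> a i \<le> n"
proof
  have k': "colon_kills f i (a i)" if "i \<in> {1..r}" for i using k[OF that] by simp
  note fwd = perturb_all[OF f k' ar N eps f']
  have ec: "\<epsilon> i \<in> carrier R" if "i \<in> {1..r}" for i by (rule P_carr[OF eps[OF that]])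
  have f'c: "f' i \<in> carrier R" if "i \<in> {1..r}" for i using f'[OF that] f[OF that] ec[OF that] by simp
  show "colon_kills f' i n" if "a i \<le> n"
    using fwd(1)[OF _ _ _ _ _ i] kills_mono[OF _ that] unfolding colon_kills_def by blast
  assume kn: "colon_kills f' i n"
  show "a i \<le> n"
  proof (rule ccontr)
    assume "\<not> a i \<le> n"
    define a' where "a' = a(i := n)"
    have "(\<Sum>i=1..r. a' i) \<le> (\<Sum>i=1..r. a i)"
      using \<open>\<not> a i \<le> n\<close> by (intro sum_mono) (simp add: a'_def)
    hence N': "(\<Sum>i=1..r. a' i) < N" using N by simp
    have k1: "colon_kills f' l (a' l)" if "l \<in> {1..r}" for l
      using kn fwd(1)[OF _ _ _ _ _ that] by (simp add: a'_def)
    have ar': "artin_rees R J (seq_ideal R f' l) < N" if l: "l \<in> {1..r}" for l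
    proof -
      have "ideal (seq_ideal R f l) R" "ideal (seq_ideal R f' l) R"
        using l by (intro ideal_seq_ideal f f'c; auto)+
      from in_sub_artin_rees_eq[OF this fwd(2,3)[OF _ _ _ _ _ l]] show ?thesis using ar[OF l] by simp
    qed
    have e': "\<ominus> \<epsilon> l \<in> P N" if "l \<in> {1..r}" for l by (rule ideal_a_inv_closed[OF ideal_P eps[OF that]])
    have ff: "f l = f' l \<oplus> \<ominus> \<epsilon> l" if "l \<in> {1..r}" for l
      using f'[OF that] f[OF that] ec[OF that] by (simp add: a_assoc r_neg)
    have "colon_kills f i (a' i)" by (rule perturb_all(1)[OF f'c k1 ar' N' e' ff i])
    hence "a i \<le> n" using k[OF i] by (simp add: a'_def)
    thus False using \<open>\<not> a i \<le> n\<close> by simp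
  qed
qed

end

section \<open>Cosets, Loewy lengths and graded rings\<close>

context cring
begin

lemma coset_eq_iff:
  "ideal I R \<Longrightarrow> a \<in> carrier R \<Longrightarrow> b \<in> carrier R \<Longrightarrow> I +> a = I +> b \<longleftrightarrow> a \<ominus> b \<in> I"
  by (simp add: quotient_eq_iff_same_a_r_cos)

lemma coset_eq_self_iff:
  assumes "ideal I R" "a \<in> carrier R"
  shows "I +> a = I \<longleftrightarrow> a \<in> I"
proof -
  have "I +> \<zero> = I" using ideal_carr[OF assms(1)] by (force simp: a_r_coset_def')
  moreover have "a \<ominus> \<zero> = a" using assms(2) by (simp add: a_minus_def)
  ultimately show ?thesis using coset_eq_iff[OF assms zero_closed] by simp
qed

lemma mem_coset_iff:
  assumes "ideal I R" "a \<in> carrier R"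
  shows "x \<in> I +> a \<longleftrightarrow> x \<in> carrier R \<and> x \<ominus> a \<in> I"
proof
  assume "x \<in> I +> a"
  then obtain i where i: "i \<in> I" "x = i \<oplus> a" by (auto simp: a_r_coset_def')
  have "i \<in> carrier R" by (rule ideal_carr[OF assms(1) i(1)])
  thus "x \<in> carrier R \<and> x \<ominus> a \<in> I" using i a_minus_eqI[OF i(2)] assms(2) by simp
next
  assume x: "x \<in> carrier R \<and> x \<ominus> a \<in> I"
  have "x = (x \<ominus> a) \<oplus> a" using x assms(2) by algebra
  thus "x \<in> I +> a" using x by (auto simp: a_r_coset_def')
qed

lemma coset_self: "ideal I R \<Longrightarrow> a \<in> carrier R \<Longrightarrow> a \<in> I +> a"
  by (simp add: mem_coset_iff a_minus_def r_neg ideal_zero_closed)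

lemma coset_add:
  "ideal I R \<Longrightarrow> a \<in> carrier R \<Longrightarrow> b \<in> carrier R \<Longrightarrow> (I +> a) <+>\<^bsub>R\<^esub> (I +> b) = I +> (a \<oplus> b)"
  by (rule ideal.a_rcos_sum)

lemma UN_coset_eq:
  assumes "\<And>x. x \<in> C \<Longrightarrow> \<phi> x = D" "C \<noteq> {}"
  shows "(\<Union>x\<in>C. \<phi> x) = D"
  using assms by auto

lemma smult_quot_module:
  assumes B: "ideal B R" and r: "r \<in> carrier R" and a: "a \<in> carrier R"
  shows "r \<odot>\<^bsub>quot_module R A B\<^esub> (B +> a) = B +> (r \<otimes> a)"
proof -
  have "B +> (r \<otimes> x) = B +> (r \<otimes> a)" if "x \<in> B +> a" for x
  proof -
    have x: "x \<in> carrier R" "x \<ominus> a \<in> B" using that mem_coset_iff[OF B a] by blast+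
    have "r \<otimes> x \<ominus> r \<otimes> a = r \<otimes> (x \<ominus> a)" using x(1) r a by algebra
    also have "\<dots> \<in> B" by (rule ideal.I_l_closed[OF B x(2) r])
    finally show ?thesis using coset_eq_iff[OF B] x(1) r a by simp
  qed
  moreover have "B +> a \<noteq> {}" using coset_self[OF B a] by blast
  ultimately have "(\<Union>x\<in>B +> a. B +> (r \<otimes> x)) = B +> (r \<otimes> a)" by (rule UN_coset_eq)
  thus ?thesis by (simp add: quot_module_def)
qed

text \<open>Turns the annihilation of the quotient by \<open>K\<close> into an inclusion in
  \<open>R\<close>. As \<open>ideal_smult\<close> is an intersection of submodules, it suffices that
  the zero coset alone forms a submodule and belongs to every submodule.\<close>

lemma ideal_smult_quot_module_eq_zero_iff:
  assumes A: "ideal A R" and B: "ideal B R" and K: "K \<subseteq> carrier R"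
  shows "ideal_smult R K (quot_module R A B) = {\<zero>\<^bsub>quot_module R A B\<^esub>} \<longleftrightarrow> (\<forall>u\<in>K. \<forall>x\<in>A. u \<otimes> x \<in> B)"
proof -
  let ?M = "quot_module R A B"
  have zero: "\<zero>\<^bsub>?M\<^esub> = B" and carr: "carrier ?M = (\<lambda>a. B +> a) ` A"
    and add: "x \<oplus>\<^bsub>?M\<^esub> y = x <+>\<^bsub>R\<^esub> y" for x y
    by (simp_all add: quot_module_def)
  have B0: "B +> \<zero> = B" using coset_eq_self_iff[OF B zero_closed] ideal_zero_closed[OF B] by simp
  have Badd: "B <+>\<^bsub>R\<^esub> (B +> a) = B +> a" if "a \<in> carrier R" for a
    using coset_add[OF B zero_closed that] that unfolding B0 by simp
  have Bc: "B \<in> carrier ?M" unfolding carr using B0 ideal_zero_closed[OF A] by (metis image_eqI)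
  have BB: "B <+>\<^bsub>R\<^esub> B = B" using Badd[OF zero_closed] unfolding B0 .
  \<comment> \<open>The inverse is computed from its definition by uniqueness, as no group structure
    on the cosets has been established.\<close>
  have inv: "inv\<^bsub>add_monoid ?M\<^esub> B = B"
    unfolding m_inv_def
  proof (rule the_equality)
    show "B \<in> carrier (add_monoid ?M) \<and> B \<otimes>\<^bsub>add_monoid ?M\<^esub> B = \<one>\<^bsub>add_monoid ?M\<^esub> \<and>
        B \<otimes>\<^bsub>add_monoid ?M\<^esub> B = \<one>\<^bsub>add_monoid ?M\<^esub>" using Bc BB by (simp add: zero add)
    fix y assume y: "y \<in> carrier (add_monoid ?M) \<and> B \<otimes>\<^bsub>add_monoid ?M\<^esub> y = \<one>\<^bsub>add_monoid ?M\<^esub> \<and>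
        y \<otimes>\<^bsub>add_monoid ?M\<^esub> B = \<one>\<^bsub>add_monoid ?M\<^esub>"
    hence "y \<in> carrier ?M" "B <+>\<^bsub>R\<^esub> y = B" by (simp_all add: zero add)
    then obtain a where a: "a \<in> A" "y = B +> a" "B <+>\<^bsub>R\<^esub> y = B" unfolding carr by blast
    thus "y = B" using Badd[OF ideal_carr[OF A a(1)]] by simp
  qed
  have sub: "submodule {B} R ?M"
  proof
    show "{B} \<subseteq> carrier (add_monoid ?M)" using Bc by simp
    show "x \<otimes>\<^bsub>add_monoid ?M\<^esub> y \<in> {B}" if "x \<in> {B}" "y \<in> {B}" for x y using that BB by (simp add: add)
    show "\<one>\<^bsub>add_monoid ?M\<^esub> \<in> {B}" by (simp add: zero)
    show "inv\<^bsub>add_monoid ?M\<^esub> x \<in> {B}" if "x \<in> {B}" for x using that inv by simp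
    show "r \<odot>\<^bsub>?M\<^esub> x \<in> {B}" if "r \<in> carrier R" "x \<in> {B}" for r x
      using smult_quot_module[OF B that(1) zero_closed, of A] that unfolding B0 by (simp add: B0)
  qed
  have zero_mem: "B \<in> N" if "submodule N R ?M" for N
    using subgroup.one_closed[OF submodule.axioms(1)[OF that]] by (simp add: zero)
  show ?thesis unfolding zero
  proof
    assume L: "ideal_smult R K ?M = {B}"
    show "\<forall>u\<in>K. \<forall>x\<in>A. u \<otimes> x \<in> B"
    proof (intro ballI)
      fix u x assume u: "u \<in> K" and x: "x \<in> A"
      have c: "u \<in> carrier R" "x \<in> carrier R" using u K ideal_carr[OF A x] by auto
      have "B +> x \<in> carrier ?M" unfolding carr using x by blast
      hence "u \<odot>\<^bsub>?M\<^esub> (B +> x) \<in> ideal_smult R K ?M" unfolding ideal_smult_def using u by blast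
      hence "B +> (u \<otimes> x) = B" unfolding L using smult_quot_module[OF B c] by simp
      thus "u \<otimes> x \<in> B" using coset_eq_self_iff[OF B m_closed[OF c]] by blast
    qed
  next
    assume Rt: "\<forall>u\<in>K. \<forall>x\<in>A. u \<otimes> x \<in> B"
    have "u \<odot>\<^bsub>?M\<^esub> C \<in> {B}" if u: "u \<in> K" and C: "C \<in> carrier ?M" for u C
    proof -
      obtain x where x: "x \<in> A" "C = B +> x" using C unfolding carr by blast
      have c: "u \<in> carrier R" "x \<in> carrier R" using u K ideal_carr[OF A x(1)] by auto
      have "B +> (u \<otimes> x) = B" using coset_eq_self_iff[OF B m_closed[OF c]] Rt u x(1) by blast
      thus ?thesis unfolding x(2) using smult_quot_module[OF B c, of A] by simp
    qed
    hence "ideal_smult R K ?M \<subseteq> {B}" unfolding ideal_smult_def using sub by (intro Inter_lower) blast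
    moreover have "B \<in> ideal_smult R K ?M" unfolding ideal_smult_def using zero_mem by blast
    ultimately show "ideal_smult R K ?M = {B}" by blast
  qed
qed

end

section \<open>Initial ideals and graded rings through representatives\<close>

context adic_ring
begin

lemma initial_ideal_cong:
  assumes I: "ideal I R" "ideal I' R" and sub: "in_sub I I'"
  shows "initial_ideal R J I \<subseteq> initial_ideal R J I'"
proof
  fix x assume x: "x \<in> initial_ideal R J I"
  have "x n \<in> (\<lambda>a. P (Suc n) +> a) ` (I' \<inter> P n)" for n
  proof -
    obtain a where a: "a \<in> I" "a \<in> P n" "x n = P (Suc n) +> a" using x unfolding initial_ideal_def by blast
    obtain b where b: "b \<in> I'" "a \<ominus> b \<in> P (Suc n)"
      using sub a(1,2) unfolding in_sub_def by blast
    have c: "a \<in> carrier R" "b \<in> carrier R" using P_carr[OF a(2)] ideal_carr[OF I(2) b(1)] .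
    have "a \<ominus> b \<in> P n" by (rule P_antimonoD[OF _ b(2)]) simp
    hence "a \<ominus> (a \<ominus> b) \<in> P n" by (rule ideal_a_minus_closed[OF ideal_P a(2)])
    moreover have "a \<ominus> (a \<ominus> b) = b" using c by algebra
    ultimately have "b \<in> P n" by simp
    moreover have "x n = P (Suc n) +> b" unfolding a(3) using coset_eq_iff[OF ideal_P c] b(2) by blast
    ultimately show ?thesis using b(1) by blast
  qed
  thus "x \<in> initial_ideal R J I'" using x unfolding initial_ideal_def by blast
qed

text \<open>The last condition makes \<open>P n\<close> surject onto \<open>F n / F (Suc n)\<close>, so that the elements of the
  graded rings of different filtrations can be compared through representatives in \<open>P n\<close>.\<close>

definition P_filtration :: "(nat \<Rightarrow> 'a set) \<Rightarrow> bool" where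
  "P_filtration F \<longleftrightarrow> (\<forall>n. ideal (F n) R) \<and> (\<forall>m n. m \<le> n \<longrightarrow> F n \<subseteq> F m) \<and> (\<forall>n. P n \<subseteq> F n) \<and>
     (\<forall>m n. \<forall>x\<in>F m. \<forall>y\<in>F n. x \<otimes> y \<in> F (m + n)) \<and>
     (\<forall>n. \<forall>x\<in>F n. \<exists>a\<in>P n. x \<ominus> a \<in> F (Suc n))"

definition repr :: "(nat \<Rightarrow> 'a set) \<Rightarrow> (nat \<Rightarrow> 'a set) \<Rightarrow> (nat \<Rightarrow> 'a) \<Rightarrow> bool" where
  "repr F x a \<longleftrightarrow> (\<forall>n. a n \<in> P n \<and> x n = F (Suc n) +> a n)"

lemma reprD: "repr F x a \<Longrightarrow> a n \<in> P n" "repr F x a \<Longrightarrow> x n = F (Suc n) +> a n"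
  "repr F x a \<Longrightarrow> a n \<in> carrier R"
  unfolding repr_def using P_carr by blast+

context
  fixes F
  assumes F: "P_filtration F"
begin

lemma filt_ideal: "ideal (F n) R" using F unfolding P_filtration_def by blast
lemma filt_antimono: "m \<le> n \<Longrightarrow> x \<in> F n \<Longrightarrow> x \<in> F m" using F unfolding P_filtration_def by blast
lemma P_filt: "x \<in> P n \<Longrightarrow> x \<in> F n" using F unfolding P_filtration_def by blast
lemma filt_mult: "x \<in> F m \<Longrightarrow> y \<in> F n \<Longrightarrow> x \<otimes> y \<in> F (m + n)" using F unfolding P_filtration_def by blast
lemma filt_approx: "x \<in> F n \<Longrightarrow> \<exists>a\<in>P n. x \<ominus> a \<in> F (Suc n)" using F unfolding P_filtration_def by blast

lemma repr_exists:
  assumes "x \<in> carrier (graded_ring R F)"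
  shows "\<exists>a. repr F x a"
proof -
  have "\<exists>a. a \<in> P n \<and> x n = F (Suc n) +> a" for n
  proof -
    obtain y where y: "y \<in> F n" "x n = F (Suc n) +> y" using assms by (auto simp: graded_ring_def)
    obtain a where a: "a \<in> P n" "y \<ominus> a \<in> F (Suc n)" using filt_approx[OF y(1)] by blast
    have "F (Suc n) +> y = F (Suc n) +> a"
      using coset_eq_iff[OF filt_ideal ideal_carr[OF filt_ideal y(1)] P_carr[OF a(1)]] a(2) by blast
    thus ?thesis using y(2) a(1) by auto
  qed
  thus ?thesis unfolding repr_def by metis
qed

lemma repr_zero_iff: "repr F x a \<Longrightarrow> x n = F (Suc n) \<longleftrightarrow> a n \<in> F (Suc n)"
  using coset_eq_self_iff[OF filt_ideal reprD(3)] reprD(2) by metis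

lemma repr_carrier_iff:
  assumes "repr F x a"
  shows "x \<in> carrier (graded_ring R F) \<longleftrightarrow> finite {n. a n \<notin> F (Suc n)}"
proof -
  have "x n \<in> (\<lambda>a. F (Suc n) +> a) ` F n" for n
    using reprD(2)[OF assms, of n] P_filt[OF reprD(1)[OF assms, of n]] by blast
  thus ?thesis using repr_zero_iff[OF assms] by (simp add: graded_ring_def)
qed

lemma repr_add:
  assumes "repr F x a" "repr F y b"
  shows "repr F (x \<oplus>\<^bsub>graded_ring R F\<^esub> y) (\<lambda>n. a n \<oplus> b n)"
  unfolding repr_def
proof (intro allI conjI)
  fix n
  show "a n \<oplus> b n \<in> P n" by (rule ideal_a_closed[OF ideal_P reprD(1)[OF assms(1)] reprD(1)[OF assms(2)]])
  show "(x \<oplus>\<^bsub>graded_ring R F\<^esub> y) n = F (Suc n) +> (a n \<oplus> b n)"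
    using coset_add[OF filt_ideal reprD(3)[OF assms(1)] reprD(3)[OF assms(2)], of "Suc n" n n]
    by (simp add: graded_ring_def reprD(2)[OF assms(1)] reprD(2)[OF assms(2)])
qed

lemma repr_one: "repr F \<one>\<^bsub>graded_ring R F\<^esub> (\<lambda>n. if n = 0 then \<one> else \<zero>)"
  unfolding repr_def
proof (intro allI conjI)
  fix n
  have "\<one> \<in> P 0" unfolding P_0 by (rule one_closed)
  moreover have "\<zero> \<in> P n" by (rule ideal_zero_closed[OF ideal_P])
  ultimately show "(if n = 0 then \<one> else \<zero>) \<in> P n" by metis
  show "\<one>\<^bsub>graded_ring R F\<^esub> n = F (Suc n) +> (if n = 0 then \<one> else \<zero>)"
    using coset_eq_self_iff[OF filt_ideal zero_closed] ideal_zero_closed[OF filt_ideal]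
    by (simp add: graded_ring_def)
qed

text \<open>\<open>rcoset_mult\<close> is a union over all products of representatives. The cosets
  agree because u v - a b = (u - a) v + a (v - b), where v has order j and both summands have order
  i + j + 1.\<close>

lemma rcoset_mult_filt:
  assumes a: "a \<in> P i" and b: "b \<in> P j"
  shows "rcoset_mult R (F (Suc (i + j))) (F (Suc i) +> a) (F (Suc j) +> b) = F (Suc (i + j)) +> (a \<otimes> b)"
proof -
  have c: "a \<in> carrier R" "b \<in> carrier R" using P_carr[OF a] P_carr[OF b] .
  have "F (Suc (i + j)) +> (u \<otimes> v) = F (Suc (i + j)) +> (a \<otimes> b)"
    if u: "u \<in> F (Suc i) +> a" and v: "v \<in> F (Suc j) +> b" for u v
  proof -
    have u': "u \<in> carrier R" "u \<ominus> a \<in> F (Suc i)" using u mem_coset_iff[OF filt_ideal c(1)] by blast+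
    have v': "v \<in> carrier R" "v \<ominus> b \<in> F (Suc j)" using v mem_coset_iff[OF filt_ideal c(2)] by blast+
    have "v \<ominus> b \<in> F j" by (rule filt_antimono[OF _ v'(2)]) simp
    hence "(v \<ominus> b) \<oplus> b \<in> F j" by (rule ideal_a_closed[OF filt_ideal _ P_filt[OF b]])
    moreover have "(v \<ominus> b) \<oplus> b = v" using v'(1) c by algebra
    ultimately have "v \<in> F j" by simp
    hence "(u \<ominus> a) \<otimes> v \<in> F (Suc i + j)" by (rule filt_mult[OF u'(2)])
    moreover have "a \<otimes> (v \<ominus> b) \<in> F (i + Suc j)" by (rule filt_mult[OF P_filt[OF a] v'(2)])
    ultimately have "(u \<ominus> a) \<otimes> v \<oplus> a \<otimes> (v \<ominus> b) \<in> F (Suc (i + j))"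
      using ideal_a_closed[OF filt_ideal] by simp
    moreover have "u \<otimes> v \<ominus> a \<otimes> b = (u \<ominus> a) \<otimes> v \<oplus> a \<otimes> (v \<ominus> b)" using u'(1) v'(1) c by algebra
    ultimately show ?thesis using coset_eq_iff[OF filt_ideal m_closed[OF u'(1) v'(1)] m_closed[OF c]] by simp
  qed
  thus ?thesis unfolding rcoset_mult_def
    using coset_self[OF filt_ideal c(1)] coset_self[OF filt_ideal c(2)] by (intro UN_coset_eq) blast+
qed

lemma repr_mult:
  assumes x: "repr F x a" and y: "repr F y b"
  shows "repr F (x \<otimes>\<^bsub>graded_ring R F\<^esub> y) (\<lambda>n. finsum R (\<lambda>i. a i \<otimes> b (n - i)) {..n})"
  unfolding repr_def
proof (intro allI conjI)
  fix n
  have c: "a i \<otimes> b (n - i) \<in> carrier R" for i using reprD(3)[OF x] reprD(3)[OF y] by simp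
  have "finite A \<Longrightarrow> A \<subseteq> {..n} \<Longrightarrow> finsum R (\<lambda>i. a i \<otimes> b (n - i)) A \<in> P n" for A
  proof (induct A rule: finite_induct)
    case empty
    show ?case using ideal_zero_closed[OF ideal_P] by simp
  next
    case (insert i A)
    have "a i \<otimes> b (n - i) \<in> P (i + (n - i))" by (rule P_mult[OF reprD(1)[OF x] reprD(1)[OF y]])
    hence "a i \<otimes> b (n - i) \<in> P n" using insert.prems by simp
    moreover have "finsum R (\<lambda>i. a i \<otimes> b (n - i)) (insert i A) =
        a i \<otimes> b (n - i) \<oplus> finsum R (\<lambda>i. a i \<otimes> b (n - i)) A"
      using insert.hyps c by (intro finsum_insert) auto
    ultimately show ?case using insert.hyps(3) insert.prems ideal_a_closed[OF ideal_P] by simp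
  qed
  thus "finsum R (\<lambda>i. a i \<otimes> b (n - i)) {..n} \<in> P n" by blast
  let ?Q = "R Quot F (Suc n)"
  \<comment> \<open>The sum in the graded product is formed in the quotient ring; the canonical
    homomorphism pulls it back to a sum of representatives.\<close>
  interpret h: ring_hom_cring R ?Q "(+>) (F (Suc n))"
    by (rule ideal.rcos_ring_hom_cring[OF filt_ideal is_cring])
  have "rcoset_mult R (F (Suc n)) (x i) (y (n - i)) = F (Suc n) +> (a i \<otimes> b (n - i))" if "i \<le> n" for i
    using rcoset_mult_filt[OF reprD(1)[OF x, of i] reprD(1)[OF y, of "n - i"]] that
    by (simp add: reprD(2)[OF x] reprD(2)[OF y])
  hence "finsum ?Q (\<lambda>i. rcoset_mult R (F (Suc n)) (x i) (y (n - i))) {..n} =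
      finsum ?Q (\<lambda>i. F (Suc n) +> (a i \<otimes> b (n - i))) {..n}"
    by (intro h.S.finsum_cong'[OF refl] Pi_I h.hom_closed[OF c]) simp
  hence "(x \<otimes>\<^bsub>graded_ring R F\<^esub> y) n = finsum ?Q (\<lambda>i. F (Suc n) +> (a i \<otimes> b (n - i))) {..n}"
    by (simp only: graded_ring_def monoid.simps)
  also have "\<dots> = F (Suc n) +> finsum R (\<lambda>i. a i \<otimes> b (n - i)) {..n}"
    by (rule h.hom_finsum[OF Pi_I[OF c], unfolded comp_def, symmetric])
  finally show "(x \<otimes>\<^bsub>graded_ring R F\<^esub> y) n = F (Suc n) +> finsum R (\<lambda>i. a i \<otimes> b (n - i)) {..n}" .
qed

end

text \<open>The part of degree n is \<open>P n\<close> modulo \<open>P n \<inter> F (Suc n)\<close>,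
  and the hypothesis says that these intersections agree for \<open>F\<close> and \<open>G\<close>.
  The isomorphism keeps representatives.\<close>

lemma graded_iso_filtrations:
  assumes F: "P_filtration F" and G: "P_filtration G"
    and FG: "\<And>n a. a \<in> P n \<Longrightarrow> a \<in> F (Suc n) \<longleftrightarrow> a \<in> G (Suc n)"
  shows "graded_iso R F G"
proof -
  \<comment> \<open>The choice is harmless: two representatives in \<open>P n\<close> differ by an
    element of \<open>P n \<inter> F (Suc n)\<close>, hence of \<open>G (Suc n)\<close>. All
    properties of \<open>h\<close> are derived from this.\<close>
  define h where "h x = (\<lambda>n. G (Suc n) +> (SOME a. a \<in> P n \<and> x n = F (Suc n) +> a))" for x
  have h: "repr G (h x) a" if x: "repr F x a" for x a
    unfolding repr_def
  proof (intro allI conjI)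
    fix n
    show "a n \<in> P n" by (rule reprD(1)[OF x])
    let ?b = "SOME a. a \<in> P n \<and> x n = F (Suc n) +> a"
    have "?b \<in> P n \<and> x n = F (Suc n) +> ?b" by (rule someI[of _ "a n"]) (rule conjI[OF reprD(1)[OF x] reprD(2)[OF x]])
    hence b: "?b \<in> P n" "F (Suc n) +> ?b = F (Suc n) +> a n"
      by (rule conjunct1, metis reprD(2)[OF x])
    hence "?b \<ominus> a n \<in> F (Suc n)" using coset_eq_iff[OF filt_ideal[OF F] P_carr[OF b(1)] reprD(3)[OF x]] by blast
    moreover have "?b \<ominus> a n \<in> P n" by (rule ideal_a_minus_closed[OF ideal_P b(1) reprD(1)[OF x]])
    ultimately have "?b \<ominus> a n \<in> G (Suc n)" using FG by blast
    thus "h x n = G (Suc n) +> a n"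
      unfolding h_def using coset_eq_iff[OF filt_ideal[OF G] P_carr[OF b(1)] reprD(3)[OF x]] by blast
  qed
  have repr_eq: "x = y" if "repr F' x a" "repr F' y a" for F' x y a
    using that unfolding repr_def by (intro ext) simp
  have carr_iff: "x \<in> carrier (graded_ring R F) \<longleftrightarrow> y \<in> carrier (graded_ring R G)"
    if "repr F x a" "repr G y a" for x y a
    unfolding repr_carrier_iff[OF F that(1)] repr_carrier_iff[OF G that(2)]
    using FG reprD(1)[OF that(1)] by simp
  have zero_iff: "h x n = G (Suc n) \<longleftrightarrow> x n = F (Suc n)" if x: "x \<in> carrier (graded_ring R F)" for x n
  proof -
    obtain a where a: "repr F x a" using repr_exists[OF F x] by blast
    show ?thesis unfolding repr_zero_iff[OF F a] repr_zero_iff[OF G h[OF a]] using FG[OF reprD(1)[OF a]] by blast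
  qed
  have closed: "h x \<in> carrier (graded_ring R G)" if x: "x \<in> carrier (graded_ring R F)" for x
  proof -
    obtain a where a: "repr F x a" using repr_exists[OF F x] by blast
    show ?thesis using carr_iff[OF a h[OF a]] x by blast
  qed
  have surj: "\<exists>x\<in>carrier (graded_ring R F). h x = y" if y: "y \<in> carrier (graded_ring R G)" for y
  proof -
    obtain a where a: "repr G y a" using repr_exists[OF G y] by blast
    define x where "x = (\<lambda>n. F (Suc n) +> a n)"
    have x: "repr F x a" unfolding repr_def x_def using reprD(1)[OF a] by blast
    have "h x = y" by (rule repr_eq[OF h[OF x] a])
    thus ?thesis using carr_iff[OF x a] y by blast
  qed
  have inj: "x = y" if x: "x \<in> carrier (graded_ring R F)" and y: "y \<in> carrier (graded_ring R F)"
    and xy: "h x = h y" for x y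
  proof
    fix n
    obtain a where a: "repr F x a" using repr_exists[OF F x] by blast
    obtain b where b: "repr F y b" using repr_exists[OF F y] by blast
    have "G (Suc n) +> a n = G (Suc n) +> b n" using reprD(2)[OF h[OF a]] reprD(2)[OF h[OF b]] xy by metis
    hence "a n \<ominus> b n \<in> G (Suc n)" using coset_eq_iff[OF filt_ideal[OF G] reprD(3)[OF a] reprD(3)[OF b]] by blast
    moreover have "a n \<ominus> b n \<in> P n" by (rule ideal_a_minus_closed[OF ideal_P reprD(1)[OF a] reprD(1)[OF b]])
    ultimately have "a n \<ominus> b n \<in> F (Suc n)" using FG by blast
    thus "x n = y n" unfolding reprD(2)[OF a] reprD(2)[OF b]
      using coset_eq_iff[OF filt_ideal[OF F] reprD(3)[OF a] reprD(3)[OF b]] by blast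
  qed
  have "h \<in> ring_iso (graded_ring R F) (graded_ring R G)"
  proof (rule ring_iso_memI)
    show "bij_betw h (carrier (graded_ring R F)) (carrier (graded_ring R G))"
      unfolding bij_betw_def inj_on_def using inj closed surj by blast
    show "h \<one>\<^bsub>graded_ring R F\<^esub> = \<one>\<^bsub>graded_ring R G\<^esub>" by (rule repr_eq[OF h[OF repr_one[OF F]] repr_one[OF G]])
    fix x y assume xy: "x \<in> carrier (graded_ring R F)" "y \<in> carrier (graded_ring R F)"
    obtain a where a: "repr F x a" using repr_exists[OF F xy(1)] by blast
    obtain b where b: "repr F y b" using repr_exists[OF F xy(2)] by blast
    show "h (x \<otimes>\<^bsub>graded_ring R F\<^esub> y) = h x \<otimes>\<^bsub>graded_ring R G\<^esub> h y"
      by (rule repr_eq[OF h[OF repr_mult[OF F a b]] repr_mult[OF G h[OF a] h[OF b]]])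
    show "h (x \<oplus>\<^bsub>graded_ring R F\<^esub> y) = h x \<oplus>\<^bsub>graded_ring R G\<^esub> h y"
      by (rule repr_eq[OF h[OF repr_add[OF F a b]] repr_add[OF G h[OF a] h[OF b]]])
  qed (rule closed)
  moreover have "h ` homogeneous_part R F n = homogeneous_part R G n" for n
  proof
    show "h ` homogeneous_part R F n \<subseteq> homogeneous_part R G n"
      unfolding homogeneous_part_def by (rule image_subsetI) (simp add: closed zero_iff)
    show "homogeneous_part R G n \<subseteq> h ` homogeneous_part R F n"
    proof
      fix y assume y: "y \<in> homogeneous_part R G n"
      then obtain x where x: "x \<in> carrier (graded_ring R F)" "h x = y"
        using surj[of y] unfolding homogeneous_part_def by blast
      have "x \<in> homogeneous_part R F n"
        using y x(1) zero_iff[OF x(1)] unfolding homogeneous_part_def x(2) by blast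
      thus "y \<in> h ` homogeneous_part R F n" using x(2) by blast
    qed
  qed
  ultimately show ?thesis unfolding graded_iso_def by blast
qed

lemma mem_adic_filtration:
  "x \<in> adic_filtration R J I n \<longleftrightarrow> (\<exists>p\<in>P n. \<exists>i\<in>I. x = p \<oplus> i)"
  unfolding adic_filtration_def by (rule set_add_iff)

lemma P_filtration_adic:
  assumes I: "ideal I R"
  shows "P_filtration (adic_filtration R J I)"
proof -
  let ?F = "adic_filtration R J I"
  have FI: "ideal (?F n) R" for n unfolding adic_filtration_def by (rule add_ideals[OF ideal_P I])
  have PF: "P n \<subseteq> ?F n" and IF: "I \<subseteq> ?F n" for n
    unfolding adic_filtration_def using subset_set_add[OF ideal_P I] by auto
  have "?F n \<subseteq> ?F m" if "m \<le> n" for m n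
    using P_antimonoD[OF that] unfolding mem_adic_filtration subset_iff by blast
  moreover have "x \<otimes> y \<in> ?F (m + n)" if x: "x \<in> ?F m" and y: "y \<in> ?F n" for m n x y
  proof -
    obtain p i where pi: "p \<in> P m" "i \<in> I" "x = p \<oplus> i" using x unfolding mem_adic_filtration by blast
    obtain q j where qj: "q \<in> P n" "j \<in> I" "y = q \<oplus> j" using y unfolding mem_adic_filtration by blast
    have c: "p \<in> carrier R" "i \<in> carrier R" "q \<in> carrier R" "j \<in> carrier R"
      using P_carr[OF pi(1)] ideal_carr[OF I pi(2)] P_carr[OF qj(1)] ideal_carr[OF I qj(2)] .
    have "x \<otimes> y = p \<otimes> q \<oplus> (p \<otimes> j \<oplus> (q \<oplus> j) \<otimes> i)" unfolding pi(3) qj(3) using c by algebra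
    moreover have "p \<otimes> j \<oplus> (q \<oplus> j) \<otimes> i \<in> I"
      using c pi(2) qj(2) by (intro ideal_a_closed[OF I] ideal.I_l_closed[OF I]) simp_all
    ultimately show ?thesis unfolding mem_adic_filtration using P_mult[OF pi(1) qj(1)] by blast
  qed
  moreover have "\<exists>a\<in>P n. x \<ominus> a \<in> ?F (Suc n)" if x: "x \<in> ?F n" for n x
  proof -
    obtain p i where pi: "p \<in> P n" "i \<in> I" "x = p \<oplus> i" using x unfolding mem_adic_filtration by blast
    have c: "p \<in> carrier R" "i \<in> carrier R" using P_carr[OF pi(1)] ideal_carr[OF I pi(2)] .
    have "x \<ominus> p = i" unfolding pi(3) using c by algebra
    thus ?thesis using pi(1,2) IF by blast
  qed
  ultimately show ?thesis unfolding P_filtration_def using FI PF by blast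
qed

text \<open>If p + i has order n and p has order n + 1, then i has order n, so it is replaced by an
  element of \<open>I'\<close> up to order n + 1.\<close>

lemma in_sub_adic_filtration:
  assumes I: "ideal I R" "ideal I' R" and sub: "in_sub I I'"
    and a: "a \<in> P n" "a \<in> adic_filtration R J I (Suc n)"
  shows "a \<in> adic_filtration R J I' (Suc n)"
proof -
  obtain p i where pi: "p \<in> P (Suc n)" "i \<in> I" "a = p \<oplus> i" using a(2) unfolding mem_adic_filtration by blast
  have c: "p \<in> carrier R" "i \<in> carrier R" using P_carr[OF pi(1)] ideal_carr[OF I(1) pi(2)] .
  have "p \<in> P n" by (rule P_antimonoD[OF _ pi(1)]) simp
  hence "a \<ominus> p \<in> P n" by (rule ideal_a_minus_closed[OF ideal_P a(1)])
  moreover have "a \<ominus> p = i" unfolding pi(3) using c by algebra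
  ultimately have "i \<in> P n" by simp
  then obtain i' where i': "i' \<in> I'" "i \<ominus> i' \<in> P (Suc n)" using sub pi(2) unfolding in_sub_def by blast
  have c': "i' \<in> carrier R" by (rule ideal_carr[OF I(2) i'(1)])
  have "a = (p \<oplus> (i \<ominus> i')) \<oplus> i'" unfolding pi(3) using c c' by algebra
  thus ?thesis unfolding mem_adic_filtration using ideal_a_closed[OF ideal_P pi(1) i'(2)] i'(1) by blast
qed

lemma in_sub_graded_iso:
  assumes I: "ideal I R" "ideal I' R" and sub: "in_sub I I'" "in_sub I' I"
  shows "graded_iso R (adic_filtration R J I) (adic_filtration R J I')"
proof (rule graded_iso_filtrations[OF P_filtration_adic[OF I(1)] P_filtration_adic[OF I(2)]])
  fix n a assume a: "a \<in> P n"
  show "a \<in> adic_filtration R J I (Suc n) \<longleftrightarrow> a \<in> adic_filtration R J I' (Suc n)"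
    using in_sub_adic_filtration[OF I sub(1) a] in_sub_adic_filtration[OF I(2,1) sub(2) a] by blast
qed

end

section \<open>Loewy lengths as thresholds\<close>

text \<open>An exact length becomes an equivalence that holds for all \<open>n\<close>, so the lower
  bound is available as an implication. The infimum is attained because a finite value excludes the
  empty set.\<close>

lemma Inf_enat_eq_iff:
  fixes Q :: "nat \<Rightarrow> bool"
  assumes up: "\<And>m n. Q m \<Longrightarrow> m \<le> n \<Longrightarrow> Q n"
  shows "Inf {enat n |n. Q n} = enat a \<longleftrightarrow> (\<forall>n. Q n \<longleftrightarrow> a \<le> n)"
proof
  assume L: "Inf {enat n |n. Q n} = enat a"
  have "{enat n |n. Q n} \<noteq> {}"
  proof
    assume "{enat n |n. Q n} = {}"
    thus False using L by (simp only:) (simp add: Inf_enat_def)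
  qed
  then obtain m where "Q m" by blast
  hence "Inf {enat n |n. Q n} \<in> {enat n |n. Q n}" by (intro wellorder_InfI[of "enat m"]) blast
  hence "Q a" unfolding L by simp
  moreover have "a \<le> n" if "Q n" for n
    using Inf_lower[of "enat n" "{enat n |n. Q n}"] that unfolding L by auto
  ultimately show "\<forall>n. Q n \<longleftrightarrow> a \<le> n" using up by blast
next
  assume Rt: "\<forall>n. Q n \<longleftrightarrow> a \<le> n"
  show "Inf {enat n |n. Q n} = enat a"
    by (rule Inf_eqI) (use Rt in auto)
qed

lemma (in adic_ring) loewy_length_colon_quot:
  assumes f: "\<And>k. k \<in> {1..i} \<Longrightarrow> f k \<in> carrier R" and i: "i \<ge> 1"
  shows "loewy_length R J (colon_quot R f i) = Inf {enat n |n. colon_kills f i n}"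
proof -
  have "f i \<in> carrier R" using i by (intro f) simp
  moreover have B: "ideal (seq_ideal R f (i - 1)) R" using i by (intro ideal_seq_ideal f) auto
  ultimately have A: "ideal (colon_ideal R (seq_ideal R f (i - 1)) (f i)) R" by (intro ideal_colon_ideal)
  have "P n \<subseteq> carrier R" for n using P_carr by blast
  thus ?thesis
    unfolding loewy_length_def colon_quot_def colon_kills_def kills_def
    by (simp only: ideal_smult_quot_module_eq_zero_iff[OF A B])
qed

lemma (in adic_ring) loewy_length_colon_quot_eq_iff:
  assumes "\<And>k. k \<in> {1..i} \<Longrightarrow> f k \<in> carrier R" and "i \<ge> 1"
  shows "loewy_length R J (colon_quot R f i) = enat a \<longleftrightarrow> (\<forall>n. colon_kills f i n \<longleftrightarrow> a \<le> n)"
proof -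
  have "loewy_length R J (colon_quot R f i) = Inf {enat n |n. colon_kills f i n}"
    by (rule loewy_length_colon_quot) (use assms in simp_all)
  moreover have "colon_kills f i n" if "colon_kills f i m" "m \<le> n" for m n
    using that kills_mono unfolding colon_kills_def by blast
  ultimately show ?thesis using Inf_enat_eq_iff[of "colon_kills f i" a] by simp
qed

theorem theorem1p1:
  fixes R :: "('a, 'b) ring_scheme"
    and \<mm> J :: "'a set"
    and f f' \<epsilon> :: "nat \<Rightarrow> 'a"
    and a :: "nat \<Rightarrow> nat"
    and r b N :: nat
  assumes "noetherian_ring R" and "local_ring R \<mm>"
    and "ideal J R" and "J \<noteq> carrier R"
    and "r \<ge> 1"
    and "filter_regular R J r f"
    and "\<And>i. i \<in> {1..r} \<Longrightarrow> loewy_length R J (colon_quot R f i) = enat (a i)"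
    and "b = Max (a ` {1..r})"
    and "N = Max ({(\<Sum>i=1..r. a i) + b} \<union>
                  (\<lambda>i. artin_rees R J (seq_ideal R f i)) ` {1..r}) + 1"
    and "\<And>i. i \<in> {1..r} \<Longrightarrow> \<epsilon> i \<in> ideal_pow R J N"
    and "\<And>i. i \<in> {1..r} \<Longrightarrow> f' i = f i \<oplus>\<^bsub>R\<^esub> \<epsilon> i"
  shows "filter_regular R J r f' \<and>
         (\<forall>i\<in>{1..r}. loewy_length R J (colon_quot R f' i) = enat (a i)) \<and>
         (\<forall>i\<in>{1..r}. initial_ideal R J (seq_ideal R f' i) = initial_ideal R J (seq_ideal R f i)) \<and>
         graded_iso R (adic_filtration R J (seq_ideal R f' r))
                      (adic_filtration R J (seq_ideal R f r)) \<and>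
         artin_rees R J (seq_ideal R f' r) = artin_rees R J (seq_ideal R f r)"
proof -
  have "cring R" using assms(2) by (simp add: local_ring_def)
  then interpret local_adic_ring R J \<mm>
    using assms(1-4) by (simp add: local_adic_ring_def noetherian_adic_ring_def adic_ring_def
        adic_ring_axioms_def local_adic_ring_axioms_def)
  let ?S = "{(\<Sum>i=1..r. a i) + b} \<union> (\<lambda>i. artin_rees R J (seq_ideal R f i)) ` {1..r}"
  have N: "s < N" if "s \<in> ?S" for s
  proof -
    have "s \<le> Max ?S" by (rule Max_ge) (use that in simp_all)
    thus ?thesis using assms(9) by simp
  qed
  have sum: "(\<Sum>i=1..r. a i) < N" using N[of "(\<Sum>i=1..r. a i) + b"] by simp
  have ar: "artin_rees R J (seq_ideal R f i) < N" if "i \<in> {1..r}" for i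
    using that by (intro N) blast
  have f: "f i \<in> carrier R" if "i \<in> {1..r}" for i
    using assms(6) that unfolding filter_regular_def by blast
  have f': "f' i \<in> carrier R" if "i \<in> {1..r}" for i
    using assms(11)[OF that] f[OF that] P_carr[OF assms(10)[OF that]] by simp
  \<comment> \<open>The lengths are carried from \<open>f\<close> to \<open>f'\<close> in threshold
    form and converted back afterwards.\<close>
  have k: "colon_kills f i n \<longleftrightarrow> a i \<le> n" if i: "i \<in> {1..r}" for i n
    using loewy_length_colon_quot_eq_iff[of i f "a i"] f assms(7)[OF i] i by simp
  have k': "colon_kills f' i n \<longleftrightarrow> a i \<le> n" if i: "i \<in> {1..r}" for i n
    by (rule perturb_colon_kills_iff[OF f k ar sum assms(10,11) i])
  have loewy: "loewy_length R J (colon_quot R f' i) = enat (a i)" if i: "i \<in> {1..r}" for i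
    using loewy_length_colon_quot_eq_iff[of i f' "a i"] f' k'[OF i] i by simp
  have I: "ideal (seq_ideal R f i) R" "ideal (seq_ideal R f' i) R" if i: "i \<in> {1..r}" for i
    by (rule ideal_seq_ideal, rule f, use i in simp, rule ideal_seq_ideal, rule f', use i in simp)
  have ka: "colon_kills f i (a i)" if "i \<in> {1..r}" for i using k[OF that] by simp
  note sub = perturb_all(2,3)[OF f ka ar sum assms(10,11)]
  have "filter_regular R J r f'" unfolding filter_regular_def using f' loewy by simp
  moreover have "initial_ideal R J (seq_ideal R f' i) = initial_ideal R J (seq_ideal R f i)"
    if i: "i \<in> {1..r}" for i
    by (rule subset_antisym[OF initial_ideal_cong[OF I(2,1)[OF i] sub(2)[OF _ _ _ _ _ i]]
          initial_ideal_cong[OF I[OF i] sub(1)[OF _ _ _ _ _ i]]])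
  moreover have r: "r \<in> {1..r}" using assms(5) by simp
  have "graded_iso R (adic_filtration R J (seq_ideal R f' r)) (adic_filtration R J (seq_ideal R f r))"
    by (rule in_sub_graded_iso[OF I(2,1)[OF r] sub(2,1)[OF _ _ _ _ _ r]])
  moreover have "artin_rees R J (seq_ideal R f' r) = artin_rees R J (seq_ideal R f r)"
    by (rule in_sub_artin_rees_eq[OF I[OF r] sub[OF _ _ _ _ _ r]])
  ultimately show ?thesis using loewy by blast
qed

end
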